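(* Let $(X_k)_k$ be a sequence of i.i.d. symmetric real random variables with the same law as $X$, where $\mathbb{E}(X)=0$, $\mathbb{E}(X^2)=1$ and $\mathbb{E}(X^4)<3$. Set $$Z_n:=\frac1{n^{1/4}}\sum_{k=1}^nX_k,\quad \gamma_n:=n^{1/4},\quad C:=\frac{3-\mathbb{E}(X^4)}6,$$ and let $H_n\sim\mathscr{H}(\Phi_C,\gamma_n)$. Then, for all $h\in\mathcal{H}^2_\Phi$ and all $n\geq1$, $$\big|\mathbb{E}(h(Z_n))-\mathbb{E}(h(H_n))\big|\leq\Big(3+2C+\frac{35C}{\gamma_n^4}\Big)\frac{2-3C}{\gamma_n^2}\|h''\|_\infty+\frac{66\,C}{\gamma_n^3}\|h'\|_\infty.$$ In particular (as $n\to\infty$), $$d_{\mathcal{H}^2_\Phi}(Z_n,H_n)\leq\frac{(3+2C)(2-3C)}{\gamma_n^2}+O\Big(\frac1{\gamma_n^3}\Big),\qquad d_{\mathcal{H}^2_\Phi}\Big(\frac{Z_n}{\gamma_n},\frac{H_n}{\gamma_n}\Big)\leq\frac{(3+2C)(2-3C)}{\gamma_n^4}+O\Big(\frac1{\gamma_n^8}\Big).$$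
   Context: $X$ symmetric means that $X$ and $-X$ have the same law. With $\Phi_C(x):=e^{-Cx^4/4}$ and $\gamma>0$, $\mathscr{H}(\Phi_C,\gamma)$ is the probability distribution on $\mathbb{R}$ with density proportional to $\Phi_C(x/\gamma^2)e^{-x^2/(2\gamma^2)}=\exp\big(-\frac{x^2}{2\gamma^2}-\frac{C}{\gamma^8}\frac{x^4}4\big)$. Moreover $$\mathcal{H}^2_\Phi:=\Big\{h\in\mathcal{C}^2(\mathbb{R}) : \|h\|_\infty\leq1,\ \|h'\|_\infty\leq1,\ \|h''\|_\infty\leq1,\ \lim_{\pm\infty}h=\lim_{\pm\infty}h'=0,\ \int_{\mathbb{R}}|h'|<\infty,\ \int_{\mathbb{R}}|h''|<\infty\Big\},$$ $$d_{\mathcal{H}^2_\Phi}(U,V):=\sup_{h\in\mathcal{H}^2_\Phi}\big|\mathbb{E}(h(U))-\mathbb{E}(h(V))\big|$$ for real random variables $U,V$. *)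

theory Defs
  imports "HOL-Probability.Probability" "HOL-Library.Landau_Symbols"
begin

definition symmetric_rv :: "'a measure \<Rightarrow> ('a \<Rightarrow> real) \<Rightarrow> bool" where
  "symmetric_rv M X \<longleftrightarrow> distr M borel X = distr M borel (\<lambda>\<omega>. - X \<omega>)"

definition Phi :: "real \<Rightarrow> real \<Rightarrow> real" where
  "Phi C x = exp (- C * x ^ 4 / 4)"

definition H_weight :: "(real \<Rightarrow> real) \<Rightarrow> real \<Rightarrow> real \<Rightarrow> real" where
  "H_weight \<Phi> \<gamma> x = \<Phi> (x / \<gamma>\<^sup>2) * exp (- x\<^sup>2 / (2 * \<gamma>\<^sup>2))"

text \<open>A probability measure whenever \<open>\<gamma> > 0\<close> and the weight is nonnegative and
  integrable with positive integral.\<close>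

definition H_law :: "(real \<Rightarrow> real) \<Rightarrow> real \<Rightarrow> real measure" where
  "H_law \<Phi> \<gamma> =
     density lborel (\<lambda>x. ennreal (H_weight \<Phi> \<gamma> x / (\<integral>y. H_weight \<Phi> \<gamma> y \<partial>lborel)))"

text \<open>The uniform norm; the supremum is taken in \<open>real\<close>, so it is meaningful only for
  bounded functions.\<close>

definition sup_norm :: "(real \<Rightarrow> real) \<Rightarrow> real" where
  "sup_norm f = (SUP x. \<bar>f x\<bar>)"

text \<open>The bounds \<open>\<parallel>f\<parallel>\<^sub>\<infinity> \<le> 1\<close> are stated pointwise, because \<open>sup_norm\<close> carries no
  information about unbounded functions.\<close>

definition H2_Phi :: "(real \<Rightarrow> real) set" where
  "H2_Phi = {h.
     h differentiable_on UNIV \<and> deriv h differentiable_on UNIV \<and>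
     continuous_on UNIV (deriv (deriv h)) \<and>
     (\<forall>x. \<bar>h x\<bar> \<le> 1) \<and> (\<forall>x. \<bar>deriv h x\<bar> \<le> 1) \<and> (\<forall>x. \<bar>deriv (deriv h) x\<bar> \<le> 1) \<and>
     (h \<longlongrightarrow> 0) at_top \<and> (h \<longlongrightarrow> 0) at_bot \<and>
     (deriv h \<longlongrightarrow> 0) at_top \<and> (deriv h \<longlongrightarrow> 0) at_bot \<and>
     integrable lborel (\<lambda>x. \<bar>deriv h x\<bar>) \<and>
     integrable lborel (\<lambda>x. \<bar>deriv (deriv h) x\<bar>)}"

text \<open>The variables \<open>U\<close> and \<open>V\<close> may live on different probability spaces \<open>M\<close> and \<open>N\<close>.
  The supremum is over a nonempty set of reals bounded by 2.\<close>

definition d_H2_Phi ::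
  "'a measure \<Rightarrow> ('a \<Rightarrow> real) \<Rightarrow> 'b measure \<Rightarrow> ('b \<Rightarrow> real) \<Rightarrow> real" where
  "d_H2_Phi M U N V =
     (SUP h\<in>H2_Phi. \<bar>(\<integral>\<omega>. h (U \<omega>) \<partial>M) - (\<integral>\<omega>. h (V \<omega>) \<partial>N)\<bar>)"

lemma H2_Phi_zero: "(\<lambda>_. 0) \<in> H2_Phi"
proof -
  have "deriv (\<lambda>_::real. 0::real) = (\<lambda>_. 0)"
    by (rule ext) simp
  then show ?thesis
    by (simp add: H2_Phi_def)
qed

lemma H_weight_Phi:
  assumes "\<gamma> > 0"
  shows "H_weight (Phi C) \<gamma> x = exp (- (x\<^sup>2 / (2 * \<gamma>\<^sup>2)) - C / \<gamma> ^ 8 * (x ^ 4 / 4))"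
  unfolding H_weight_def Phi_def
  by (simp add: mult_exp_exp power_divide flip: power_mult)

end

(*
  Both Z_n / gamma_n = S_n / sqrt n and H_n / gamma_n are compared with a standard Gaussian G.
  Let g be the bounded solution of the Stein equation g' - x g = f - E f(G); it satisfies
  |g| <= |f'| and |g'''| <= 4 |f''| in the uniform norm. A Taylor expansion of g in each summand
  of S_n, whose first three moments are Gaussian, gives
  |E f(S_n / sqrt n) - E f(G)| <= 4 (1 - C) |f''| / n.
  The law of H_n / gamma_n has weight w(x) = exp (- x^2 / 2 - (C / n) x^4 / 4); integrating (g w)'
  gives E f(H_n / gamma_n) - E f(G) = (C / n) E (x^3 g(x)), and the third absolute moment of this
  law is at most 2. The resulting bound (4 (1 - C) |f''| + 2 C |f'|) / n is below the claimed ones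
  because 0 <= C <= 1 / 3; in the second distance estimate the remainder can be taken to be 0.
*)

theory Submission
  imports Defs "HOL-Real_Asymp.Real_Asymp"
begin

section \<open>Maximum principle and decay for the Gaussian Stein equation\<close>

text \<open>No Gaussian variable appears in the formal argument. Both laws are compared with the
  same constant \<open>c\<close>, the Gaussian mean that gives the Stein equation a bounded
  solution, and \<open>c\<close> drops out in a triangle inequality. The delicate point is the
  factor 4 in the bound for the third derivative. Instead of estimating an explicit integral formula
  for \<open>g\<close>, the proof looks at second-order equations for \<open>g\<close> and
  \<open>g'\<close> at a positive maximum, where the first derivative vanishes. A maximum exists
  only if the function is already known to decay, so each derivative first gets a bound on
  \<open>x * w x\<close> from a first-order equation w' = x w + q. This estimate is used for
  \<open>g\<close>, \<open>g'\<close> and \<open>g''\<close> in turn. The different rates come from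
  scaling. For Z_n and H_n the test function is h(gamma x), whose first and second derivatives carry
  gamma and gamma^2, so 1 / n = 1 / gamma^4 becomes 1 / gamma^3 and 1 / gamma^2. For the rescaled
  variables the test function is h itself.\<close>

lemma second_derivative_at_max_nonpos:
  fixes u :: "real \<Rightarrow> real"
  assumes u1: "\<And>x. (u has_real_derivative u1 x) (at x)"
    and u2: "(u1 has_real_derivative d) (at x0)"
    and max: "\<And>x. u x \<le> u x0"
  shows "u1 x0 = 0" and "d \<le> 0"
proof -
  show u10: "u1 x0 = 0"
    using DERIV_local_max[OF u1[of x0], of 1] max by simp
  show "d \<le> 0"
  proof (rule ccontr)
    assume "\<not> d \<le> 0"
    then obtain e where e: "e > 0" "\<And>t. t > 0 \<Longrightarrow> t < e \<Longrightarrow> u1 x0 < u1 (x0 + t)"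
      using DERIV_pos_inc_right[OF u2] by auto
    have "u x0 < u (x0 + e / 2)"
    proof (rule DERIV_pos_imp_increasing_open[where f = u])
      fix x assume "x0 < x" "x < x0 + e / 2"
      then have "u1 x > 0" using e(2)[of "x - x0"] u10 by simp
      then show "\<exists>y. (u has_real_derivative y) (at x) \<and> y > 0" using u1 by blast
    next
      show "continuous_on {x0..x0 + e / 2} u"
        by (rule DERIV_continuous_on[OF has_field_derivative_at_within[OF u1]])
    qed (use e in simp)
    with max[of "x0 + e / 2"] show False by simp
  qed
qed

text \<open>Outside a compact interval \<open>u\<close> stays below the positive value
  \<open>u x1\<close>, so the maximum over that interval is global.\<close>

lemma vanishing_continuous_attains_positive_max:
  fixes u :: "real \<Rightarrow> real"
  assumes cont: "continuous_on UNIV u"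
    and top: "(u \<longlongrightarrow> 0) at_top" and bot: "(u \<longlongrightarrow> 0) at_bot"
    and pos: "u x1 > 0"
  obtains x0 where "\<And>x. u x \<le> u x0" "u x0 > 0"
proof -
  obtain A where A: "\<And>x. x \<ge> A \<Longrightarrow> u x < u x1"
    using order_tendstoD(2)[OF top pos] by (auto simp: eventually_at_top_linorder)
  obtain B where B: "\<And>x. x \<le> B \<Longrightarrow> u x < u x1"
    using order_tendstoD(2)[OF bot pos] by (auto simp: eventually_at_bot_linorder)
  have x1: "B < x1" "x1 < A" using A[of x1] B[of x1] by linarith+
  obtain x0 where x0: "x0 \<in> {B..A}" "\<And>x. x \<in> {B..A} \<Longrightarrow> u x \<le> u x0"
    using continuous_attains_sup[of "{B..A}" u] continuous_on_subset[OF cont, of "{B..A}"] x1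
    by auto
  have "u x1 \<le> u x0" using x0(2)[of x1] x1 by simp
  moreover have "u x \<le> u x0" for x
    using x0(2)[of x] A[of x] B[of x] \<open>u x1 \<le> u x0\<close> by (simp, linarith)
  ultimately show thesis using that[of x0] pos by fastforce
qed

text \<open>At a positive global maximum \<open>u1\<close> vanishes and \<open>u2\<close> is at most
  0, so the equation reduces to \<open>l * u x0 = u2 x0 - r x0 \<le> K\<close>. The unbounded drift
  coefficient \<open>x\<close> disappears together with \<open>u1\<close>.\<close>

lemma maximum_principle_upper:
  fixes u :: "real \<Rightarrow> real"
  assumes u1: "\<And>x. (u has_real_derivative u1 x) (at x)"
    and u2: "\<And>x. (u1 has_real_derivative u2 x) (at x)"
    and eq: "\<And>x. u2 x - x * u1 x - l * u x = r x"
    and r: "\<And>x. \<bar>r x\<bar> \<le> K" and l: "l > 0"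
    and top: "(u \<longlongrightarrow> 0) at_top" and bot: "(u \<longlongrightarrow> 0) at_bot"
  shows "l * u x \<le> K"
proof (cases "u x > 0")
  case True
  have "continuous_on UNIV u"
    by (rule DERIV_continuous_on[OF u1])
  then obtain x0 where x0: "\<And>y. u y \<le> u x0"
    using vanishing_continuous_attains_positive_max[OF _ top bot True] by blast
  have "u1 x0 = 0" "u2 x0 \<le> 0"
    using second_derivative_at_max_nonpos[OF u1 u2 x0] by auto
  then have "l * u x0 \<le> K" using eq[of x0] r[of x0] by auto
  moreover have "l * u x \<le> l * u x0" using x0 l by simp
  ultimately show ?thesis by simp
next
  case False
  then have "l * u x \<le> 0" using l by (simp add: mult_le_0_iff)
  moreover have "0 \<le> K" using r[of 0] by simp
  ultimately show ?thesis by simp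
qed

lemma maximum_principle:
  fixes u :: "real \<Rightarrow> real"
  assumes u1: "\<And>x. (u has_real_derivative u1 x) (at x)"
    and u2: "\<And>x. (u1 has_real_derivative u2 x) (at x)"
    and eq: "\<And>x. u2 x - x * u1 x - l * u x = r x"
    and r: "\<And>x. \<bar>r x\<bar> \<le> K" and l: "l > 0"
    and top: "(u \<longlongrightarrow> 0) at_top" and bot: "(u \<longlongrightarrow> 0) at_bot"
  shows "l * \<bar>u x\<bar> \<le> K"
proof -
  have "l * u x \<le> K"
    by (rule maximum_principle_upper[OF u1 u2 eq r l top bot])
  moreover have "l * (- u x) \<le> K"
  proof (rule maximum_principle_upper[where u = "\<lambda>x. - u x" and r = "\<lambda>x. - r x"])
    show "((\<lambda>x. - u x) has_real_derivative - u1 x) (at x)"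
      "((\<lambda>x. - u1 x) has_real_derivative - u2 x) (at x)" for x
      using u1 u2 by (auto intro: DERIV_minus)
    show "- u2 x - x * - u1 x - l * - u x = - r x" for x using eq[of x] by simp
  qed (use r l tendsto_minus[OF top] tendsto_minus[OF bot] in simp_all)
  ultimately show ?thesis by (cases "u x \<ge> 0") simp_all
qed

text \<open>Comparison of \<open>exp (- x\<^sup>2 / 2) * w x\<close> with \<open>K * exp (- x\<^sup>2 / 2) / x\<close>.\<close>

lemma stein_solution_decay_upper:
  fixes w :: "real \<Rightarrow> real"
  assumes w: "\<And>x. (w has_real_derivative x * w x + q x) (at x)"
    and q: "\<And>x. \<bar>q x\<bar> \<le> K"
    and top: "((\<lambda>x. exp (- x\<^sup>2 / 2) * w x) \<longlongrightarrow> 0) at_top"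
    and x: "x > 0"
  shows "x * w x \<le> K"
proof -
  define F where "F = (\<lambda>x. exp (- x\<^sup>2 / 2) * w x - K * exp (- x\<^sup>2 / 2) / x)"
  have K: "K \<ge> 0" using q[of 0] by simp
  \<comment> \<open>The integrating factor cancels \<open>x * w x\<close> and leaves
    \<open>q\<close>, while the comparison term contributes \<open>K + K / y\<^sup>2\<close>. As
    \<open>q \<ge> - K\<close>, \<open>F\<close> increases towards its limit 0 and is therefore at
    most 0.\<close>
  have F': "(F has_real_derivative exp (- y\<^sup>2 / 2) * (q y + K + K / y\<^sup>2)) (at y)" if "y > 0" for y
    unfolding F_def using that
    by (auto intro!: derivative_eq_intros w simp: field_simps power2_eq_square)
  have mono: "F x \<le> F y" if "y \<ge> x" for y
  proof (rule DERIV_nonneg_imp_nondecreasing[OF that])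
    fix z assume "x \<le> z" "z \<le> y"
    then have "z > 0" using x by simp
    moreover have "0 \<le> exp (- z\<^sup>2 / 2) * (q z + K + K / z\<^sup>2)"
      using q[of z] K by (intro mult_nonneg_nonneg add_nonneg_nonneg[of "q z + K"]) auto
    ultimately show "\<exists>d. (F has_real_derivative d) (at z) \<and> d \<ge> 0" using F' by blast
  qed
  have "((\<lambda>x::real. exp (- x\<^sup>2 / 2) / x) \<longlongrightarrow> 0) at_top" by real_asymp
  from tendsto_diff[OF top tendsto_mult_left[OF this, of K]]
  have "(F \<longlongrightarrow> 0) at_top" unfolding F_def by simp
  then have "F x \<le> 0"
    by (rule tendsto_lowerbound) (auto intro!: eventually_mono[OF eventually_ge_at_top[of x]] mono)
  then have "exp (- x\<^sup>2 / 2) * w x \<le> exp (- x\<^sup>2 / 2) * (K / x)"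
    unfolding F_def by (simp add: mult.commute)
  then have "w x \<le> K / x" by (rule mult_left_le_imp_le) simp
  then show ?thesis using x by (simp add: field_simps)
qed

text \<open>The equation is invariant under changing the sign of \<open>w\<close> and
  \<open>q\<close>, and under reflecting \<open>x\<close> with \<open>q x\<close> replaced by
  \<open>- q (- x)\<close>; the one-sided estimate thus covers both signs and both half-lines. The
  two limits exclude multiples of the homogeneous solution
  \<open>exp (x\<^sup>2 / 2)\<close>.\<close>

lemma stein_solution_decay:
  fixes w :: "real \<Rightarrow> real"
  assumes w: "\<And>x. (w has_real_derivative x * w x + q x) (at x)"
    and q: "\<And>x. \<bar>q x\<bar> \<le> K"
    and top: "((\<lambda>x. exp (- x\<^sup>2 / 2) * w x) \<longlongrightarrow> 0) at_top"
    and bot: "((\<lambda>x. exp (- x\<^sup>2 / 2) * w x) \<longlongrightarrow> 0) at_bot"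
  shows "\<bar>x * w x\<bar> \<le> K"
proof -
  have pos: "\<bar>x * v x\<bar> \<le> K"
    if v: "\<And>x. (v has_real_derivative x * v x + p x) (at x)" and p: "\<And>x. \<bar>p x\<bar> \<le> K"
      and top: "((\<lambda>x. exp (- x\<^sup>2 / 2) * v x) \<longlongrightarrow> 0) at_top" and x: "x > 0" for v p x
  proof -
    have "x * v x \<le> K" by (rule stein_solution_decay_upper[OF v p top x])
    moreover have "x * (- v x) \<le> K"
    proof (rule stein_solution_decay_upper[where w = "\<lambda>x. - v x" and q = "\<lambda>x. - p x"])
      show "((\<lambda>x. - v x) has_real_derivative x * - v x + - p x) (at x)" for x
        using DERIV_minus[OF v[of x]] by simp
      show "((\<lambda>x. exp (- x\<^sup>2 / 2) * - v x) \<longlongrightarrow> 0) at_top" using tendsto_minus[OF top] by simp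
    qed (use p x in auto)
    ultimately show ?thesis by simp
  qed
  consider "x > 0" | "x = 0" | "x < 0" by linarith
  then show ?thesis
  proof cases
    case 1 then show ?thesis using pos[OF w q top] by simp
  next
    case 2 then show ?thesis using q[of 0] by simp
  next
    case 3
    have "\<bar>- x * w (- (- x))\<bar> \<le> K"
    proof (rule pos[where v = "\<lambda>x. w (- x)" and p = "\<lambda>x. - q (- x)"])
      show "((\<lambda>x. w (- x)) has_real_derivative x * w (- x) + - q (- x)) (at x)" for x
        using DERIV_chain2[OF w DERIV_minus[OF DERIV_ident]] by simp
      show "((\<lambda>x. exp (- x\<^sup>2 / 2) * w (- x)) \<longlongrightarrow> 0) at_top"
        using bot by (simp add: filterlim_at_bot_mirror)
    qed (use q 3 in auto)
    then show ?thesis by simp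
  qed
qed

text \<open>Supplies the boundary conditions of \<open>stein_solution_decay\<close> for a function
  already known to be bounded.\<close>

lemma gaussian_mult_bounded_tendsto_0:
  fixes w :: "real \<Rightarrow> real"
  assumes "\<And>x. \<bar>w x\<bar> \<le> B"
  shows "((\<lambda>x. exp (- x\<^sup>2 / 2) * w x) \<longlongrightarrow> 0) at_top"
    and "((\<lambda>x. exp (- x\<^sup>2 / 2) * w x) \<longlongrightarrow> 0) at_bot"
proof -
  have "((\<lambda>x::real. exp (- x\<^sup>2 / 2)) \<longlongrightarrow> 0) at_top" "((\<lambda>x::real. exp (- x\<^sup>2 / 2)) \<longlongrightarrow> 0) at_bot"
    by real_asymp+
  from this[THEN tendsto_mult_right_zero, of B]
  have 1: "((\<lambda>x::real. B * exp (- x\<^sup>2 / 2)) \<longlongrightarrow> 0) at_top"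
    and 2: "((\<lambda>x::real. B * exp (- x\<^sup>2 / 2)) \<longlongrightarrow> 0) at_bot" .
  have le: "norm (exp (- x\<^sup>2 / 2) * w x) \<le> B * exp (- x\<^sup>2 / 2)" for x
    using assms by (simp add: abs_mult mult.commute)
  show "((\<lambda>x. exp (- x\<^sup>2 / 2) * w x) \<longlongrightarrow> 0) at_top"
    by (rule Lim_null_comparison[OF always_eventually 1]) (use le in simp)
  show "((\<lambda>x. exp (- x\<^sup>2 / 2) * w x) \<longlongrightarrow> 0) at_bot"
    by (rule Lim_null_comparison[OF always_eventually 2]) (use le in simp)
qed

lemma eventually_lt_at_bot_0: "\<forall>\<^sub>F x::real in at_bot. x < 0"
  by (rule eventually_at_bot_linorderI[of "-1"]) simp

text \<open>Converts the conclusion of \<open>stein_solution_decay\<close> into the decay that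
  \<open>maximum_principle\<close> requires.\<close>

lemma tendsto_0_of_mult_bounded:
  fixes w :: "real \<Rightarrow> real"
  assumes "\<And>x. \<bar>x * w x\<bar> \<le> B"
  shows "(w \<longlongrightarrow> 0) at_top" and "(w \<longlongrightarrow> 0) at_bot"
proof -
  have le: "norm (w x) \<le> B / \<bar>x\<bar>" if "x \<noteq> 0" for x
    using assms[of x] that by (simp add: pos_le_divide_eq abs_mult mult.commute)
  have "((\<lambda>x::real. 1 / \<bar>x\<bar>) \<longlongrightarrow> 0) at_top" "((\<lambda>x::real. 1 / \<bar>x\<bar>) \<longlongrightarrow> 0) at_bot"
    by real_asymp+
  from this[THEN tendsto_mult_right_zero, of B]
  have 1: "((\<lambda>x::real. B / \<bar>x\<bar>) \<longlongrightarrow> 0) at_top" and 2: "((\<lambda>x::real. B / \<bar>x\<bar>) \<longlongrightarrow> 0) at_bot"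
    by simp_all
  show "(w \<longlongrightarrow> 0) at_top"
    by (rule Lim_null_comparison[OF eventually_mono[OF eventually_gt_at_top[of 0]] 1], rule le) simp
  show "(w \<longlongrightarrow> 0) at_bot"
    by (rule Lim_null_comparison[OF eventually_mono[OF eventually_lt_at_bot_0] 2], rule le) simp
qed

section \<open>Primitives that start from minus infinity\<close>

lemma tendsto_integral_left_tail:
  fixes q :: "real \<Rightarrow> real"
  assumes q: "integrable lborel q"
  shows "((\<lambda>x. \<integral>y. indicator {..x} y * q y \<partial>lborel) \<longlongrightarrow> 0) at_bot"
  unfolding filterlim_at_bot_mirror
proof -
  have "((\<lambda>x. \<integral>y. indicator {..- x} y * q y \<partial>lborel) \<longlongrightarrow> (\<integral>y. 0 \<partial>(lborel :: real measure))) at_top"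
  proof (rule integral_dominated_convergence_at_top[where w = "\<lambda>y. \<bar>q y\<bar>"])
    show "AE y in lborel. ((\<lambda>x. indicator {..- x} y * q y) \<longlongrightarrow> 0) at_top"
    proof (rule AE_I2)
      fix y :: real
      show "((\<lambda>x. indicator {..- x} y * q y) \<longlongrightarrow> 0) at_top"
        by (rule tendsto_eventually, rule eventually_mono[OF eventually_gt_at_top[of "- y"]]) auto
    qed
  qed (use q in \<open>auto simp: abs_mult split: split_indicator\<close>)
  then show "((\<lambda>x. \<integral>y. indicator {..- x} y * q y \<partial>lborel) \<longlongrightarrow> 0) at_top" by simp
qed

text \<open>The fundamental theorem of calculus is applied on a compact interval, so the left tail
  is split at \<open>x - 1\<close>; this makes \<open>x\<close> an interior point and leaves a
  constant outside.\<close>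

lemma has_derivative_integral_left_tail:
  fixes q :: "real \<Rightarrow> real"
  assumes q: "integrable lborel q" and cont: "continuous_on UNIV q"
  shows "((\<lambda>x. \<integral>y. indicator {..x} y * q y \<partial>lborel) has_real_derivative q x) (at x)"
proof -
  define G where "G = (\<lambda>x. \<integral>y. indicator {..x} y * q y \<partial>lborel)"
  define F where "F = (\<lambda>y. LBINT t=ereal (x - 1)..ereal y. q t)"
  have intI: "integrable lborel (\<lambda>y. indicator A y * q y)" if "A \<in> sets lborel" for A
    using integrable_mult_indicator[OF that q] by simp
  have G: "G y = G (x - 1) + F y" if "y \<in> {x - 1..x + 1}" for y
  proof -
    have "F y = (\<integral>t. indicator {x - 1<..y} t * q t \<partial>lborel)"
      unfolding F_def using that
      by (simp add: interval_integral_Ioc set_lebesgue_integral_def)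
    moreover have "G y = (\<integral>t. indicator {..x - 1} t * q t + indicator {x - 1<..y} t * q t \<partial>lborel)"
      unfolding G_def by (rule Bochner_Integration.integral_cong)
        (use that in \<open>auto split: split_indicator\<close>)
    ultimately show ?thesis
      unfolding G_def by (simp add: intI)
  qed
  have "(F has_vector_derivative q x) (at x within {x - 1..x + 1})"
    unfolding F_def
    by (rule interval_integral_FTC2) (use continuous_on_subset[OF cont] in auto)
  then have F': "(F has_real_derivative q x) (at x)"
    by (simp add: has_real_derivative_iff_has_vector_derivative at_within_Icc_at)
  have "((\<lambda>y. G (x - 1) + F y) has_real_derivative q x) (at x)"
    using DERIV_add[OF DERIV_const F', of "G (x - 1)"] by simp
  then have "(G has_real_derivative q x) (at x)"
    by (rule has_field_derivative_transform_within_open[where S = "{x - 1<..<x + 1}"])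
       (simp_all add: G[symmetric])
  then show ?thesis unfolding G_def .
qed

section \<open>The bounded solution of the Stein equation\<close>

text \<open>Compactness handles the interval from -1 to 1; outside it,
  \<open>\<bar>w x\<bar> \<le> \<bar>x * w x\<bar>\<close>.\<close>

lemma bounded_of_mult_bounded:
  fixes w :: "real \<Rightarrow> real"
  assumes cont: "continuous_on UNIV w" and K: "\<And>x. \<bar>x * w x\<bar> \<le> K"
  obtains D where "\<And>x. \<bar>w x\<bar> \<le> D"
proof -
  have "compact (w ` {-1..1})"
    by (intro compact_continuous_image continuous_on_subset[OF cont]) auto
  then obtain D where "\<forall>y \<in> w ` {-1..1}. \<bar>y\<bar> \<le> D"
    using compact_imp_bounded bounded_real by blast
  then have D: "\<bar>w x\<bar> \<le> D" if "x \<in> {-1..1}" for x using that by (rule bspec[OF _ imageI])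
  have "\<bar>w x\<bar> \<le> max D K" for x
  proof (cases "x \<in> {-1..1}")
    case True
    then show ?thesis using D[OF True] by linarith
  next
    case False
    then have "\<bar>x\<bar> \<ge> 1" by auto
    then have "1 * \<bar>w x\<bar> \<le> \<bar>x\<bar> * \<bar>w x\<bar>" by (rule mult_right_mono) simp
    then show ?thesis using K[of x] unfolding abs_mult by linarith
  qed
  then show thesis by (rule that)
qed

lemma integrable_gaussian_moment: "integrable lborel (\<lambda>x::real. exp (- x\<^sup>2 / 2) * \<bar>x\<bar> ^ k)"
proof -
  have "integrable lborel (\<lambda>x. sqrt (2 * pi) * (std_normal_density x * \<bar>x\<bar> ^ k))"
    by (intro integrable_mult_right integrable_std_normal_moment_abs)
  then show ?thesis by (simp add: std_normal_density_def)
qed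

lemma integrable_gaussian: "integrable lborel (\<lambda>x::real. exp (- x\<^sup>2 / 2))"
  using integrable_gaussian_moment[of 0] by simp

lemma integral_gaussian_pos: "(\<integral>x. exp (- x\<^sup>2 / 2) \<partial>lborel) > (0::real)"
proof -
  have "(\<integral>x. std_normal_density x \<partial>lborel) = 1"
    using integral_std_normal_moment_even[of 0] by simp
  then have "1 / sqrt (2 * pi) * (\<integral>x. exp (- x\<^sup>2 / 2) \<partial>lborel) = 1"
    by (simp only: std_normal_density_def integral_mult_right_zero)
  then have "0 < 1 / sqrt (2 * pi) * (\<integral>x. exp (- x\<^sup>2 / 2) \<partial>lborel)" by linarith
  then show ?thesis by (rule zero_less_mult_pos) simp
qed

text \<open>Variation of constants from minus infinity. Taking \<open>c\<close> as the Gaussian mean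
  of \<open>f\<close> makes the integral of \<open>q\<close> over the whole line vanish, so the
  primitive \<open>G\<close> tends to 0 at both ends. These limits are the boundary conditions under
  which \<open>stein_solution_decay\<close> bounds \<open>x * g x\<close> although \<open>g\<close>
  contains the factor \<open>exp (x\<^sup>2 / 2)\<close>.\<close>

lemma gaussian_stein_equation_bounded_solution:
  fixes f :: "real \<Rightarrow> real"
  assumes cont: "continuous_on UNIV f" and f: "\<And>x. \<bar>f x\<bar> \<le> B"
  obtains c g K where "\<And>x. (g has_real_derivative x * g x + (f x - c)) (at x)"
    and "\<And>x. \<bar>g x\<bar> \<le> K" and "\<And>x. \<bar>x * g x\<bar> \<le> K"
proof -
  have [measurable]: "f \<in> borel_measurable borel" using cont by (rule borel_measurable_continuous_onI)
  define c where "c = (\<integral>x. f x * exp (- x\<^sup>2 / 2) \<partial>lborel) / (\<integral>x. exp (- x\<^sup>2 / 2) \<partial>lborel)"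
  define q where "q x = (f x - c) * exp (- x\<^sup>2 / 2)" for x
  define G where "G x = (\<integral>y. indicator {..x} y * q y \<partial>lborel)" for x
  define g where "g x = exp (x\<^sup>2 / 2) * G x" for x
  have int_f: "integrable lborel (\<lambda>x. f x * exp (- x\<^sup>2 / 2))"
  proof (rule Bochner_Integration.integrable_bound)
    show "integrable lborel (\<lambda>x. B * exp (- x\<^sup>2 / 2))"
      by (intro integrable_mult_right integrable_gaussian)
    show "AE x in lborel. norm (f x * exp (- x\<^sup>2 / 2)) \<le> norm (B * exp (- x\<^sup>2 / 2))"
      using order_trans[OF f abs_ge_self] by (simp add: abs_mult)
  qed simp
  have int_q: "integrable lborel q"
    unfolding q_def left_diff_distrib
    by (intro Bochner_Integration.integrable_diff int_f integrable_mult_right integrable_gaussian)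
  have "integral\<^sup>L lborel q = 0"
    unfolding q_def left_diff_distrib using int_f integrable_gaussian integral_gaussian_pos
    by (simp add: c_def)
  then have top: "(G \<longlongrightarrow> 0) at_top"
    using tendsto_integral_at_top[OF _ int_q] by (simp add: G_def[abs_def])
  have bot: "(G \<longlongrightarrow> 0) at_bot"
    using tendsto_integral_left_tail[OF int_q] by (simp add: G_def[abs_def])
  have "continuous_on UNIV q" unfolding q_def by (intro continuous_intros cont) simp
  from has_derivative_integral_left_tail[OF int_q this]
  have G': "(G has_real_derivative q x) (at x)" for x by (simp add: G_def[abs_def])
  have g': "(g has_real_derivative x * g x + (f x - c)) (at x)" for x
  proof -
    have "exp (x\<^sup>2 / 2) * q x = f x - c"
      by (simp add: q_def mult.left_commute flip: exp_add)
    then show ?thesis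
      unfolding g_def by (auto intro!: derivative_eq_intros G' simp: mult.commute)
  qed
  have G_eq: "exp (- x\<^sup>2 / 2) * g x = G x" for x
    by (simp add: g_def mult.assoc[symmetric] flip: exp_add)
  have xg: "\<bar>x * g x\<bar> \<le> B + \<bar>c\<bar>" for x
  proof (rule stein_solution_decay[OF g'])
    show "\<bar>f x - c\<bar> \<le> B + \<bar>c\<bar>" for x using f[of x] by linarith
  qed (simp_all only: G_eq top bot)
  moreover obtain D where "\<And>x. \<bar>g x\<bar> \<le> D"
    using bounded_of_mult_bounded[OF DERIV_continuous_on[OF g'] xg] by blast
  ultimately show thesis
    using that[OF g', of "max D (B + \<bar>c\<bar>)"] by (simp add: le_max_iff_disj)
qed

text \<open>Differentiating \<open>g' - x g = f - c\<close> once and twice gives \<open>g'' - x g' - g = f'\<close> and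
  \<open>g''' - x g'' - 2 g' = f''\<close>. The maximum principle bounds \<open>g\<close> and \<open>g'\<close>; the last equation
  is then of the original type for \<open>g''\<close>, with right-hand side bounded by \<open>2 b\<close>.\<close>

lemma gaussian_stein_solution:
  fixes f f1 f2 :: "real \<Rightarrow> real"
  assumes f1: "\<And>x. (f has_real_derivative f1 x) (at x)"
    and f2: "\<And>x. (f1 has_real_derivative f2 x) (at x)"
    and B: "\<And>x. \<bar>f x\<bar> \<le> B" and a: "\<And>x. \<bar>f1 x\<bar> \<le> a" and b: "\<And>x. \<bar>f2 x\<bar> \<le> b"
  obtains c g g1 g2 g3 D where
    "\<And>x. (g has_real_derivative g1 x) (at x)"
    "\<And>x. (g1 has_real_derivative g2 x) (at x)"
    "\<And>x. (g2 has_real_derivative g3 x) (at x)"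
    "\<And>x. g1 x = x * g x + (f x - c)"
    "\<And>x. \<bar>g x\<bar> \<le> a" "\<And>x. \<bar>g1 x\<bar> \<le> D" "\<And>x. \<bar>g2 x\<bar> \<le> D" "\<And>x. \<bar>g3 x\<bar> \<le> 4 * b"
proof -
  obtain g c K where g: "\<And>x. (g has_real_derivative x * g x + (f x - c)) (at x)"
    and gK: "\<And>x. \<bar>g x\<bar> \<le> K" and xgK: "\<And>x. \<bar>x * g x\<bar> \<le> K"
    by (rule gaussian_stein_equation_bounded_solution[OF DERIV_continuous_on[OF f1] B]) (rule that)
  define g1 where "g1 x = x * g x + (f x - c)" for x
  define g2 where "g2 x = x * g1 x + (g x + f1 x)" for x
  define g3 where "g3 x = x * g2 x + (2 * g1 x + f2 x)" for x
  have d1: "(g has_real_derivative g1 x) (at x)" for x using g by (simp add: g1_def)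
  have d2: "(g1 has_real_derivative g2 x) (at x)" for x
    unfolding g1_def[abs_def] by (auto intro!: derivative_eq_intros d1 f1 simp: g2_def g1_def)
  have d3: "(g2 has_real_derivative g3 x) (at x)" for x
    unfolding g2_def[abs_def] by (auto intro!: derivative_eq_intros d1 d2 f2 simp: g3_def g2_def)
  \<comment> \<open>The bounds in terms of \<open>K\<close>, \<open>B\<close> and \<open>c\<close>
    are qualitative. They give the decay that the maximum principle needs, which then produces
    bounds in \<open>a\<close> and \<open>b\<close> alone for \<open>g\<close>, \<open>g1\<close>
    and \<open>g3\<close>.\<close>
  have g1K: "\<bar>g1 x\<bar> \<le> K + B + \<bar>c\<bar>" for x
    using xgK[of x] B[of x] unfolding g1_def by linarith
  have q1: "\<bar>g x + f1 x\<bar> \<le> K + a" for x using gK[of x] a[of x] by linarith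
  have xg1: "\<bar>x * g1 x\<bar> \<le> K + a" for x
    by (rule stein_solution_decay[OF d2[unfolded g2_def] q1 gaussian_mult_bounded_tendsto_0[OF g1K]])
  have g2K: "\<bar>g2 x\<bar> \<le> 2 * (K + a)" for x
    using order_trans[OF abs_triangle_ineq add_mono[OF xg1 q1]] unfolding g2_def by simp
  have "1 * \<bar>g x\<bar> \<le> a" for x
  proof (rule maximum_principle[OF d1 d2 _ a])
    show "g2 x - x * g1 x - 1 * g x = f1 x" for x by (simp add: g2_def)
  qed (use tendsto_0_of_mult_bounded[OF xgK] in simp_all)
  then have ga: "\<bar>g x\<bar> \<le> a" for x by simp
  have g1b: "2 * \<bar>g1 x\<bar> \<le> b" for x
  proof (rule maximum_principle[OF d2 d3 _ b])
    show "g3 x - x * g2 x - 2 * g1 x = f2 x" for x by (simp add: g3_def)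
  qed (use tendsto_0_of_mult_bounded[OF xg1] in simp_all)
  \<comment> \<open>Here \<open>2 * b\<close> is \<open>b\<close> for \<open>2 * g1\<close> plus
    \<open>b\<close> for \<open>f2\<close>. The decay estimate passes the same bound on to
    \<open>x * g2 x\<close>, and \<open>g3\<close>, the sum of both expressions, receives
    \<open>4 * b\<close>.\<close>
  have q2: "\<bar>2 * g1 x + f2 x\<bar> \<le> 2 * b" for x using g1b[of x] b[of x] by linarith
  have xg2: "\<bar>x * g2 x\<bar> \<le> 2 * b" for x
    by (rule stein_solution_decay[OF d3[unfolded g3_def] q2 gaussian_mult_bounded_tendsto_0[OF g2K]])
  have g3b: "\<bar>g3 x\<bar> \<le> 4 * b" for x
    using order_trans[OF abs_triangle_ineq add_mono[OF xg2 q2]] unfolding g3_def by simp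
  show thesis
    by (rule that[OF d1 d2 d3 _ ga max.coboundedI1[OF g1K] max.coboundedI2[OF g2K] g3b])
       (simp add: g1_def)
qed

section \<open>The quartic perturbation of the Gaussian law\<close>

text \<open>\<open>F\<close> differs from the left-tail primitive of \<open>D\<close> by a constant.
  The limit at minus infinity shows that this constant is 0, the limit at plus infinity that it is
  minus the integral.\<close>

lemma integral_derivative_vanishing_eq_0:
  fixes F D :: "real \<Rightarrow> real"
  assumes F: "\<And>x. (F has_real_derivative D x) (at x)"
    and cont: "continuous_on UNIV D" and int: "integrable lborel D"
    and top: "(F \<longlongrightarrow> 0) at_top" and bot: "(F \<longlongrightarrow> 0) at_bot"
  shows "integral\<^sup>L lborel D = 0"
proof -
  define T where "T x = (\<integral>y. indicator {..x} y * D y \<partial>lborel)" for x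
  have "((\<lambda>x. F x - T x) has_real_derivative 0) (at x)" for x
    using DERIV_diff[OF F has_derivative_integral_left_tail[OF int cont]]
    by (simp add: T_def[abs_def])
  then have "F x - T x = F 0 - T 0" for x by (rule DERIV_isconst_all[rule_format])
  then have const: "(\<lambda>x. F x - T x) = (\<lambda>x. F 0 - T 0)" by blast
  have "((\<lambda>x. F x - T x) \<longlongrightarrow> 0 - 0) at_bot"
    unfolding T_def by (intro tendsto_diff bot tendsto_integral_left_tail int)
  then have "F 0 - T 0 = 0" unfolding const by (simp add: tendsto_const_iff)
  moreover have "((\<lambda>x. F x - T x) \<longlongrightarrow> 0 - integral\<^sup>L lborel D) at_top"
    unfolding T_def using tendsto_integral_at_top[OF _ int] by (intro tendsto_diff top) simp
  then have "F 0 - T 0 = 0 - integral\<^sup>L lborel D" unfolding const by (simp add: tendsto_const_iff)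
  ultimately show ?thesis by simp
qed

text \<open>Left unnormalised, since it enters only through quotients and relations homogeneous in
  the weight. The parameter \<open>\<epsilon>\<close> will be
  \<open>C / \<gamma> ^ 4\<close>.\<close>

definition quartic_weight :: "real \<Rightarrow> real \<Rightarrow> real" where
  "quartic_weight \<epsilon> x = exp (- x\<^sup>2 / 2 - \<epsilon> * x ^ 4 / 4)"

lemma quartic_weight_pos: "quartic_weight \<epsilon> x > 0"
  by (simp add: quartic_weight_def)

lemma quartic_weight_le: "\<epsilon> \<ge> 0 \<Longrightarrow> quartic_weight \<epsilon> x \<le> exp (- (x\<^sup>2 / 2))"
  by (simp add: quartic_weight_def)

lemma has_derivative_quartic_weight:
  "(quartic_weight \<epsilon> has_real_derivative - (x + \<epsilon> * x ^ 3) * quartic_weight \<epsilon> x) (at x)"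
  unfolding quartic_weight_def[abs_def]
  by (auto intro!: derivative_eq_intros simp: algebra_simps)

lemma continuous_on_quartic_weight: "continuous_on A (quartic_weight \<epsilon>)"
  unfolding quartic_weight_def by (intro continuous_intros) simp_all

lemma borel_measurable_quartic_weight [measurable]: "quartic_weight \<epsilon> \<in> borel_measurable borel"
  by (rule borel_measurable_continuous_onI[OF continuous_on_quartic_weight])

text \<open>For \<open>\<epsilon> \<ge> 0\<close> the weight lies below the Gaussian one, all of
  whose absolute moments are finite.\<close>

lemma integrable_quartic_weight_poly:
  fixes u :: "real \<Rightarrow> real"
  assumes e: "\<epsilon> \<ge> 0" and [measurable]: "u \<in> borel_measurable borel"
    and u: "\<And>x. \<bar>u x\<bar> \<le> B * (1 + \<bar>x\<bar> ^ k)"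
  shows "integrable lborel (\<lambda>x. u x * quartic_weight \<epsilon> x)"
proof (rule Bochner_Integration.integrable_bound)
  show "integrable lborel (\<lambda>x. B * (exp (- x\<^sup>2 / 2) + exp (- x\<^sup>2 / 2) * \<bar>x\<bar> ^ k))"
    by (intro integrable_mult_right Bochner_Integration.integrable_add integrable_gaussian
        integrable_gaussian_moment)
  have "\<bar>u x * quartic_weight \<epsilon> x\<bar> \<le> (B * (1 + \<bar>x\<bar> ^ k)) * exp (- x\<^sup>2 / 2)" for x
    unfolding abs_mult
    using quartic_weight_pos[of \<epsilon> x] order_trans[OF abs_ge_zero u]
    by (intro mult_mono u) (auto simp: quartic_weight_le[OF e])
  then show "AE x in lborel. norm (u x * quartic_weight \<epsilon> x)
      \<le> norm (B * (exp (- x\<^sup>2 / 2) + exp (- x\<^sup>2 / 2) * \<bar>x\<bar> ^ k))"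
    by (intro AE_I2) (simp add: algebra_simps order_trans[OF _ abs_ge_self])
qed simp

lemma integrable_quartic_weight_power:
  assumes "\<epsilon> \<ge> 0"
  shows "integrable lborel (\<lambda>x. x ^ k * quartic_weight \<epsilon> x)"
    and "integrable lborel (\<lambda>x. \<bar>x\<bar> ^ k * quartic_weight \<epsilon> x)"
  using assms by (auto intro!: integrable_quartic_weight_poly[where B = 1 and k = k] simp: power_abs)

lemma integral_quartic_weight_pos:
  assumes "\<epsilon> \<ge> 0"
  shows "(\<integral>x. quartic_weight \<epsilon> x \<partial>lborel) > 0"
proof -
  have int: "integrable lborel (quartic_weight \<epsilon>)"
    using integrable_quartic_weight_power(1)[OF assms, of 0] by simp
  have "(\<integral>x. quartic_weight \<epsilon> x \<partial>lborel) \<noteq> 0"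
  proof
    assume "(\<integral>x. quartic_weight \<epsilon> x \<partial>lborel) = 0"
    then have "AE x in lborel. quartic_weight \<epsilon> x = 0"
      using integral_nonneg_eq_0_iff_AE[OF int] quartic_weight_pos by (simp add: less_imp_le)
    then have "AE x in lborel :: real measure. False"
      by eventually_elim (use quartic_weight_pos less_irrefl in metis)
    then show False by (simp add: eventually_False ae_filter_eq_bot_iff)
  qed
  moreover have "(\<integral>x. quartic_weight \<epsilon> x \<partial>lborel) \<ge> 0"
    by (intro Bochner_Integration.integral_nonneg) (simp add: quartic_weight_pos less_imp_le)
  ultimately show ?thesis by simp
qed

lemma quartic_stein_identity:
  fixes g g1 :: "real \<Rightarrow> real"
  assumes e: "\<epsilon> \<ge> 0"
    and g: "\<And>x. (g has_real_derivative g1 x) (at x)" and cont: "continuous_on UNIV g1"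
    and gB: "\<And>x. \<bar>g x\<bar> \<le> B * (1 + \<bar>x\<bar> ^ k)"
    and int: "integrable lborel (\<lambda>x. (g1 x - (x + \<epsilon> * x ^ 3) * g x) * quartic_weight \<epsilon> x)"
  shows "(\<integral>x. (g1 x - (x + \<epsilon> * x ^ 3) * g x) * quartic_weight \<epsilon> x \<partial>lborel) = 0"
proof (rule integral_derivative_vanishing_eq_0[where F = "\<lambda>x. g x * quartic_weight \<epsilon> x"])
  show "((\<lambda>x. g x * quartic_weight \<epsilon> x) has_real_derivative
      (g1 x - (x + \<epsilon> * x ^ 3) * g x) * quartic_weight \<epsilon> x) (at x)" for x
    using DERIV_mult[OF g has_derivative_quartic_weight] by (simp add: algebra_simps)
  show "continuous_on UNIV (\<lambda>x. (g1 x - (x + \<epsilon> * x ^ 3) * g x) * quartic_weight \<epsilon> x)"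
    by (intro continuous_intros cont continuous_on_quartic_weight DERIV_continuous_on[OF g])
  have le: "norm (g x * quartic_weight \<epsilon> x) \<le> B * ((1 + \<bar>x\<bar> ^ k) * exp (- x\<^sup>2 / 2))" for x
    unfolding real_norm_def abs_mult mult.assoc[symmetric]
    using quartic_weight_pos[of \<epsilon> x] order_trans[OF abs_ge_zero gB]
    by (intro mult_mono gB) (auto simp: quartic_weight_le[OF e])
  have "((\<lambda>x::real. (1 + \<bar>x\<bar> ^ k) * exp (- x\<^sup>2 / 2)) \<longlongrightarrow> 0) at_top"
    "((\<lambda>x::real. (1 + \<bar>x\<bar> ^ k) * exp (- x\<^sup>2 / 2)) \<longlongrightarrow> 0) at_bot"
    by real_asymp+
  note lim = this[THEN tendsto_mult_right_zero, of B]
  show "((\<lambda>x. g x * quartic_weight \<epsilon> x) \<longlongrightarrow> 0) at_top"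
    by (rule Lim_null_comparison[OF always_eventually[OF allI[OF le]] lim(1)])
  show "((\<lambda>x. g x * quartic_weight \<epsilon> x) \<longlongrightarrow> 0) at_bot"
    by (rule Lim_null_comparison[OF always_eventually[OF allI[OF le]] lim(2)])
qed (rule int)

text \<open>Testing the Stein identity on \<open>x\<close> and on \<open>x ^ 3\<close> gives
  \<open>m 0 = m 2 + \<epsilon> * m 4\<close> and \<open>3 * m 2 = m 4 + \<epsilon> * m 6\<close>.
  Even moments are nonnegative, so \<open>m 2 \<le> m 0\<close> and
  \<open>m 4 \<le> 3 * m 0\<close>. The third absolute moment is at most half the sum of these two,
  which is the origin of the factor 2.\<close>

lemma quartic_weight_third_moment:
  assumes e: "\<epsilon> \<ge> 0"
  shows "(\<integral>x. \<bar>x\<bar> ^ 3 * quartic_weight \<epsilon> x \<partial>lborel) \<le> 2 * (\<integral>x. quartic_weight \<epsilon> x \<partial>lborel)"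
proof -
  define m where "m k = (\<integral>x. x ^ k * quartic_weight \<epsilon> x \<partial>lborel)" for k :: nat
  note int = integrable_quartic_weight_power[OF e]
  have m_nonneg: "m (2 * k) \<ge> 0" for k
    unfolding m_def
    by (intro Bochner_Integration.integral_nonneg mult_nonneg_nonneg)
       (simp_all add: quartic_weight_pos less_imp_le zero_le_even_power)
  have eq1: "(1 - (x + \<epsilon> * x ^ 3) * x) * quartic_weight \<epsilon> x =
      x ^ 0 * quartic_weight \<epsilon> x - x ^ 2 * quartic_weight \<epsilon> x - \<epsilon> * (x ^ 4 * quartic_weight \<epsilon> x)" for x
    by (simp add: algebra_simps power2_eq_square eval_nat_numeral)
  have "(\<integral>x. (1 - (x + \<epsilon> * x ^ 3) * x) * quartic_weight \<epsilon> x \<partial>lborel) = 0"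
  proof (rule quartic_stein_identity[OF e, where B = 1 and k = 1])
    show "integrable lborel (\<lambda>x. (1 - (x + \<epsilon> * x ^ 3) * x) * quartic_weight \<epsilon> x)"
      unfolding eq1 by (intro int Bochner_Integration.integrable_diff integrable_mult_right)
  qed simp_all
  then have 1: "m 0 - m 2 - \<epsilon> * m 4 = 0" unfolding eq1 m_def using int(1)[of 0] int(1)[of 2] int(1)[of 4] by simp
  have eq2: "(3 * x\<^sup>2 - (x + \<epsilon> * x ^ 3) * x ^ 3) * quartic_weight \<epsilon> x =
      3 * (x ^ 2 * quartic_weight \<epsilon> x) - x ^ 4 * quartic_weight \<epsilon> x - \<epsilon> * (x ^ 6 * quartic_weight \<epsilon> x)" for x
    by (simp add: algebra_simps power2_eq_square eval_nat_numeral)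
  have "(\<integral>x. (3 * x\<^sup>2 - (x + \<epsilon> * x ^ 3) * x ^ 3) * quartic_weight \<epsilon> x \<partial>lborel) = 0"
    by (rule quartic_stein_identity[OF e, where B = 1 and k = 3])
       (auto simp: eq2 power_abs intro!: int derivative_eq_intros continuous_intros
         Bochner_Integration.integrable_diff)
  then have 2: "3 * m 2 - m 4 - \<epsilon> * m 6 = 0" unfolding eq2 m_def using int(1)[of 2] int(1)[of 4] int(1)[of 6] by simp
  have "\<epsilon> * m 4 \<ge> 0" "\<epsilon> * m 6 \<ge> 0" using e m_nonneg[of 2] m_nonneg[of 3] by simp_all
  with 1 2 have "m 2 + m 4 \<le> 4 * m 0" by linarith
  have "(\<integral>x. \<bar>x\<bar> ^ 3 * quartic_weight \<epsilon> x \<partial>lborel)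
      \<le> (\<integral>x. (x ^ 2 * quartic_weight \<epsilon> x + x ^ 4 * quartic_weight \<epsilon> x) / 2 \<partial>lborel)"
  proof (rule integral_mono)
    fix x :: real
    \<comment> \<open>Expanding this square interpolates the third power between the second and the
      fourth.\<close>
    have "0 \<le> \<bar>x\<bar>\<^sup>2 * (1 - \<bar>x\<bar>)\<^sup>2" by simp
    then have "\<bar>x\<bar> ^ 3 \<le> (\<bar>x\<bar> ^ 2 + \<bar>x\<bar> ^ 4) / 2"
      by (simp add: algebra_simps power2_eq_square eval_nat_numeral del: zero_le_mult_iff)
    then have "\<bar>x\<bar> ^ 3 \<le> (x ^ 2 + x ^ 4) / 2" by (simp add: power_even_abs)
    then have "\<bar>x\<bar> ^ 3 * quartic_weight \<epsilon> x \<le> (x ^ 2 + x ^ 4) / 2 * quartic_weight \<epsilon> x"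
      using quartic_weight_pos[of \<epsilon> x] by (intro mult_right_mono) auto
    then show "\<bar>x\<bar> ^ 3 * quartic_weight \<epsilon> x
        \<le> (x ^ 2 * quartic_weight \<epsilon> x + x ^ 4 * quartic_weight \<epsilon> x) / 2"
      by (simp add: algebra_simps)
  qed (intro int integrable_divide Bochner_Integration.integrable_add)+
  also have "\<dots> = (m 2 + m 4) / 2" unfolding m_def using int by simp
  also have "\<dots> \<le> 2 * m 0" using \<open>m 2 + m 4 \<le> 4 * m 0\<close> by simp
  finally show ?thesis by (simp add: m_def)
qed

lemma quartic_mean_stein_bound:
  fixes f g g1 :: "real \<Rightarrow> real"
  assumes e: "\<epsilon> \<ge> 0"
    and g: "\<And>x. (g has_real_derivative g1 x) (at x)"
    and eq: "\<And>x. g1 x = x * g x + (f x - c)"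
    and cont: "continuous_on UNIV f" and f: "\<And>x. \<bar>f x\<bar> \<le> B"
    and a: "\<And>x. \<bar>g x\<bar> \<le> a"
  shows "\<bar>(\<integral>x. f x * quartic_weight \<epsilon> x \<partial>lborel) / (\<integral>x. quartic_weight \<epsilon> x \<partial>lborel) - c\<bar> \<le> 2 * \<epsilon> * a"
proof -
  define I where "I = (\<integral>x. quartic_weight \<epsilon> x \<partial>lborel)"
  define J where "J = (\<integral>x. f x * quartic_weight \<epsilon> x \<partial>lborel)"
  note int = integrable_quartic_weight_power[OF e]
  have I: "I > 0" unfolding I_def by (rule integral_quartic_weight_pos[OF e])
  have a0: "a \<ge> 0" using a[of 0] by simp
  have contg: "continuous_on UNIV g" by (rule DERIV_continuous_on[OF g])
  have [measurable]: "f \<in> borel_measurable borel" "g \<in> borel_measurable borel"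
    by (rule borel_measurable_continuous_onI, fact)+
  have int_w: "integrable lborel (quartic_weight \<epsilon>)" using int(1)[of 0] by simp
  have int_f: "integrable lborel (\<lambda>x. f x * quartic_weight \<epsilon> x)"
    by (rule integrable_quartic_weight_poly[OF e, where B = "B" and k = 0])
       (use order_trans[OF abs_ge_zero f] in \<open>auto intro: order_trans[OF f]\<close>)
  have le3: "\<bar>x ^ 3 * g x\<bar> \<le> a * \<bar>x\<bar> ^ 3" for x
    using mult_left_mono[OF a, of "\<bar>x\<bar> ^ 3" x] by (simp add: abs_mult power_abs mult.commute)
  have int_3: "integrable lborel (\<lambda>x. (x ^ 3 * g x) * quartic_weight \<epsilon> x)"
    by (rule integrable_quartic_weight_poly[OF e, where B = a and k = 3])
       (use le3 a0 in \<open>simp_all add: distrib_left add_increasing\<close>)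
  \<comment> \<open>Substituting the Gaussian Stein equation cancels \<open>x * g x\<close>; of the
    drift only the cubic part remains.\<close>
  have split: "(g1 x - (x + \<epsilon> * x ^ 3) * g x) * quartic_weight \<epsilon> x =
      f x * quartic_weight \<epsilon> x - c * quartic_weight \<epsilon> x - \<epsilon> * (x ^ 3 * g x * quartic_weight \<epsilon> x)" for x
    by (simp add: eq algebra_simps)
  have "(\<integral>x. (g1 x - (x + \<epsilon> * x ^ 3) * g x) * quartic_weight \<epsilon> x \<partial>lborel) = 0"
  proof (rule quartic_stein_identity[OF e g, where B = a and k = 0])
    show "continuous_on UNIV g1" unfolding eq by (intro continuous_intros contg cont)
    show "\<bar>g x\<bar> \<le> a * (1 + \<bar>x\<bar> ^ 0)" for x using a[of x] a0 by simp
    show "integrable lborel (\<lambda>x. (g1 x - (x + \<epsilon> * x ^ 3) * g x) * quartic_weight \<epsilon> x)"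
      unfolding split
      by (intro Bochner_Integration.integrable_diff int_f int_w int_3 integrable_mult_right)
  qed
  then have "J - c * I = \<epsilon> * (\<integral>x. x ^ 3 * g x * quartic_weight \<epsilon> x \<partial>lborel)"
    unfolding split I_def J_def using int_f int_w int_3 by simp
  moreover have "\<bar>\<integral>x. x ^ 3 * g x * quartic_weight \<epsilon> x \<partial>lborel\<bar> \<le> a * (2 * I)"
  proof -
    have "\<bar>\<integral>x. x ^ 3 * g x * quartic_weight \<epsilon> x \<partial>lborel\<bar>
        \<le> (\<integral>x. a * (\<bar>x\<bar> ^ 3 * quartic_weight \<epsilon> x) \<partial>lborel)"
    proof (rule integral_abs_bound_integral)
      show "\<bar>x ^ 3 * g x * quartic_weight \<epsilon> x\<bar> \<le> a * (\<bar>x\<bar> ^ 3 * quartic_weight \<epsilon> x)" for x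
        using mult_right_mono[OF le3, of "quartic_weight \<epsilon> x" x] quartic_weight_pos[of \<epsilon> x]
        by (simp add: abs_mult mult.assoc)
    qed (intro int_3 int integrable_mult_right)+
    also have "\<dots> \<le> a * (2 * I)"
      using quartic_weight_third_moment[OF e] a0 by (simp add: I_def mult_left_mono)
    finally show ?thesis .
  qed
  ultimately have "\<bar>J - c * I\<bar> \<le> \<epsilon> * (a * (2 * I))"
    using e by (simp add: abs_mult mult_left_mono)
  then have "\<bar>J - c * I\<bar> / I \<le> 2 * \<epsilon> * a"
    using I by (simp add: divide_le_eq mult_ac)
  moreover have "J / I - c = (J - c * I) / I" using I by (simp add: field_simps)
  then have "\<bar>J / I - c\<bar> = \<bar>J - c * I\<bar> / I" using I by simp
  ultimately show ?thesis unfolding I_def J_def by simp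
qed

text \<open>The substitution \<open>x = \<gamma> * y\<close> normalises the Gaussian factor and
  turns the quartic coefficient \<open>C / \<gamma> ^ 8\<close> into
  \<open>C / \<gamma> ^ 4\<close>.\<close>

lemma H_weight_Phi_scaled:
  assumes "\<gamma> > 0"
  shows "H_weight (Phi C) \<gamma> (\<gamma> * y) = quartic_weight (C / \<gamma> ^ 4) y"
  unfolding H_weight_Phi[OF assms] quartic_weight_def
  using assms by (simp add: power_mult_distrib field_simps eval_nat_numeral)

text \<open>The same change of variables is made in the numerator and in the normalising constant,
  and the two Jacobians \<open>\<gamma>\<close> cancel.\<close>

lemma integral_H_law_Phi:
  fixes f :: "real \<Rightarrow> real"
  assumes g: "\<gamma> > 0" and [measurable]: "f \<in> borel_measurable borel"
  shows "(\<integral>x. f (x / \<gamma>) \<partial>H_law (Phi C) \<gamma>) =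
    (\<integral>y. f y * quartic_weight (C / \<gamma> ^ 4) y \<partial>lborel) / (\<integral>y. quartic_weight (C / \<gamma> ^ 4) y \<partial>lborel)"
proof -
  have [measurable]: "H_weight (Phi C) \<gamma> \<in> borel_measurable borel"
    unfolding H_weight_def Phi_def by measurable
  define I where "I = (\<integral>y. H_weight (Phi C) \<gamma> y \<partial>lborel)"
  have pos: "H_weight (Phi C) \<gamma> x \<ge> 0" for x by (simp add: H_weight_def Phi_def)
  then have I0: "I \<ge> 0" unfolding I_def by (intro Bochner_Integration.integral_nonneg) auto
  have "(\<integral>x. f (x / \<gamma>) \<partial>H_law (Phi C) \<gamma>) = (\<integral>x. H_weight (Phi C) \<gamma> x / I * f (x / \<gamma>) \<partial>lborel)"
    unfolding H_law_def I_def[symmetric] using pos I0 by (subst integral_density) auto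
  also have "\<dots> = (\<integral>x. H_weight (Phi C) \<gamma> x * f (x / \<gamma>) \<partial>lborel) / I" by simp
  also have "(\<integral>x. H_weight (Phi C) \<gamma> x * f (x / \<gamma>) \<partial>lborel) =
      \<gamma> * (\<integral>y. f y * quartic_weight (C / \<gamma> ^ 4) y \<partial>lborel)"
    using g by (subst lborel_integral_real_affine[where c = \<gamma> and t = 0])
      (simp_all add: H_weight_Phi_scaled mult.commute[of "f _"])
  also have "I = \<gamma> * (\<integral>y. quartic_weight (C / \<gamma> ^ 4) y \<partial>lborel)"
    unfolding I_def using g by (subst lborel_integral_real_affine[where c = \<gamma> and t = 0])
      (simp_all add: H_weight_Phi_scaled)
  finally show ?thesis using g by simp
qed

section \<open>Sums of independent random variables\<close>

lemma taylor_first_order_bound: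
  fixes u :: "real \<Rightarrow> real"
  assumes u: "\<And>x. (u has_real_derivative u1 x) (at x)" "\<And>x. (u1 has_real_derivative u2 x) (at x)"
    and K: "\<And>x. \<bar>u2 x\<bar> \<le> K"
  shows "\<bar>u (v + t) - u v - t * u1 v\<bar> \<le> K * t\<^sup>2 / 2"
proof -
  \<comment> \<open>The successive derivatives of the translate of \<open>u\<close> by
    \<open>v\<close>, in the format of the Maclaurin theorem that allows both signs of
    \<open>t\<close>.\<close>
  define d where "d m s = (if m = 0 then u (v + s) else if m = 1 then u1 (v + s) else u2 (v + s))"
    for m :: nat and s
  have "(d m has_real_derivative d (Suc m) s) (at s)" if "m < 2" for m s
    using that DERIV_shift[of u _ s v] DERIV_shift[of u1 _ s v] u[of "v + s"]
    by (auto simp: d_def[abs_def] less_2_cases_iff add.commute)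
  then obtain s where "u (v + t) = (\<Sum>m<2. d m 0 / fact m * t ^ m) + d 2 s / fact 2 * t\<^sup>2"
    using Maclaurin_bi_le[of d "\<lambda>s. u (v + s)" 2 t] by (auto simp: d_def[abs_def])
  then have eq: "u (v + t) - u v - t * u1 v = u2 (v + s) * t\<^sup>2 / 2"
    by (simp add: d_def eval_nat_numeral)
  show ?thesis
    unfolding eq using mult_right_mono[OF K, of "t\<^sup>2" "v + s"] by (simp add: abs_mult)
qed

lemma taylor_second_order_bound:
  fixes u :: "real \<Rightarrow> real"
  assumes u: "\<And>x. (u has_real_derivative u1 x) (at x)" "\<And>x. (u1 has_real_derivative u2 x) (at x)"
      "\<And>x. (u2 has_real_derivative u3 x) (at x)"
    and K: "\<And>x. \<bar>u3 x\<bar> \<le> K"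
  shows "\<bar>u (v + t) - u v - t * u1 v - t\<^sup>2 / 2 * u2 v\<bar> \<le> K * \<bar>t\<bar> ^ 3 / 6"
proof -
  define d where "d m s = (if m = 0 then u (v + s) else if m = 1 then u1 (v + s)
      else if m = 2 then u2 (v + s) else u3 (v + s))" for m :: nat and s
  have "(d m has_real_derivative d (Suc m) s) (at s)" if "m < 3" for m s
  proof -
    have "m = 0 \<or> m = 1 \<or> m = 2" using that by auto
    then show ?thesis
      using DERIV_shift[of u _ s v] DERIV_shift[of u1 _ s v] DERIV_shift[of u2 _ s v] u[of "v + s"]
      by (auto simp: d_def[abs_def] add.commute)
  qed
  then obtain s where "u (v + t) = (\<Sum>m<3. d m 0 / fact m * t ^ m) + d 3 s / fact 3 * t ^ 3"
    using Maclaurin_bi_le[of d "\<lambda>s. u (v + s)" 3 t] by (auto simp: d_def[abs_def])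
  then have eq: "u (v + t) - u v - t * u1 v - t\<^sup>2 / 2 * u2 v = u3 (v + s) * t ^ 3 / 6"
    by (simp add: d_def eval_nat_numeral)
  show ?thesis
    unfolding eq using mult_right_mono[OF K, of "\<bar>t\<bar> ^ 3" "v + s"] by (simp add: abs_mult power_abs)
qed

context prob_space
begin

lemma integrable_power_le_4:
  fixes X :: "'a \<Rightarrow> real"
  assumes [measurable]: "random_variable borel X" and X4: "integrable M (\<lambda>\<omega>. X \<omega> ^ 4)" and k: "k \<le> 4"
  shows "integrable M (\<lambda>\<omega>. X \<omega> ^ k)"
proof (rule Bochner_Integration.integrable_bound)
  show "integrable M (\<lambda>\<omega>. 1 + X \<omega> ^ 4)" using X4 by simp
  have "\<bar>x\<bar> ^ k \<le> 1 + x ^ 4" for x :: real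
  proof (cases "\<bar>x\<bar> \<le> 1")
    case True
    then show ?thesis using power_le_one[of "\<bar>x\<bar>" k] by (simp add: add_increasing2)
  next
    case False
    then show ?thesis using power_increasing[OF k, of "\<bar>x\<bar>"] by (simp add: power_even_abs)
  qed
  then show "AE \<omega> in M. norm (X \<omega> ^ k) \<le> norm (1 + X \<omega> ^ 4)"
    by (intro AE_I2) (simp add: power_abs)
qed simp

lemma integrable_bounded_fun:
  fixes u :: "real \<Rightarrow> real"
  assumes "random_variable borel V" "continuous_on UNIV u" "\<And>x. \<bar>u x\<bar> \<le> B"
  shows "integrable M (\<lambda>\<omega>. u (V \<omega>))"
proof (rule integrable_const_bound[where B = B])
  have [measurable]: "u \<in> borel_measurable borel" "V \<in> borel_measurable M"
    using assms by (auto intro: borel_measurable_continuous_onI)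
  show "(\<lambda>\<omega>. u (V \<omega>)) \<in> borel_measurable M" by measurable
qed (use assms in simp)

text \<open>The terms of the expansion at \<open>V\<close> up to third order in \<open>\<delta>\<close> vanish in the mean, because the
  moments of \<open>Y\<close> up to order three are those of a standard Gaussian.\<close>

lemma stein_exchange_bound:
  fixes Y V :: "'a \<Rightarrow> real" and g :: "real \<Rightarrow> real"
  assumes ind: "indep_var borel Y borel V"
    and Y4: "integrable M (\<lambda>\<omega>. Y \<omega> ^ 4)"
    and m1: "expectation Y = 0" and m2: "expectation (\<lambda>\<omega>. (Y \<omega>)\<^sup>2) = 1"
    and m3: "expectation (\<lambda>\<omega>. Y \<omega> ^ 3) = 0"
    and g: "\<And>x. (g has_real_derivative g1 x) (at x)" "\<And>x. (g1 has_real_derivative g2 x) (at x)"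
      "\<And>x. (g2 has_real_derivative g3 x) (at x)"
    and B: "\<And>x. \<bar>g x\<bar> \<le> B" "\<And>x. \<bar>g1 x\<bar> \<le> B" "\<And>x. \<bar>g2 x\<bar> \<le> B" and K: "\<And>x. \<bar>g3 x\<bar> \<le> K"
    and d: "\<delta> > 0"
  defines "W \<equiv> \<lambda>\<omega>. V \<omega> + \<delta> * Y \<omega>"
  shows "integrable M (\<lambda>\<omega>. g1 (W \<omega>) - Y \<omega> * g (W \<omega>) / \<delta>)"
    and "\<bar>expectation (\<lambda>\<omega>. g1 (W \<omega>) - Y \<omega> * g (W \<omega>) / \<delta>)\<bar>
      \<le> \<delta>\<^sup>2 * K * (1 / 2 + expectation (\<lambda>\<omega>. Y \<omega> ^ 4) / 6)"
proof -
  have [measurable]: "random_variable borel Y" "random_variable borel V"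
    using indep_var_rv1[OF ind] indep_var_rv2[OF ind] by auto
  have [measurable]: "random_variable borel W" unfolding W_def by measurable
  note contg = DERIV_continuous_on[OF g(1)] DERIV_continuous_on[OF g(2)] DERIV_continuous_on[OF g(3)]
  have [measurable]: "g \<in> borel_measurable borel" "g1 \<in> borel_measurable borel" "g2 \<in> borel_measurable borel"
    using contg by (auto intro: borel_measurable_continuous_onI)
  have Yk: "integrable M (\<lambda>\<omega>. Y \<omega> ^ k)" if "k \<le> 4" for k
    by (rule integrable_power_le_4[OF _ Y4 that]) measurable
  have prod: "integrable M (\<lambda>\<omega>. Y \<omega> ^ k * u (V \<omega>))"
      "expectation (\<lambda>\<omega>. Y \<omega> ^ k * u (V \<omega>)) = expectation (\<lambda>\<omega>. Y \<omega> ^ k) * expectation (\<lambda>\<omega>. u (V \<omega>))"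
    if "k \<le> 4" "continuous_on UNIV u" "\<And>x. \<bar>u x\<bar> \<le> B" for k and u :: "real \<Rightarrow> real"
  proof -
    have [measurable]: "u \<in> borel_measurable borel" using that by (intro borel_measurable_continuous_onI)
    have "indep_var borel ((\<lambda>y. y ^ k) \<circ> Y) borel (u \<circ> V)"
      by (rule indep_var_compose[OF ind]) measurable
    then have "indep_var borel (\<lambda>\<omega>. Y \<omega> ^ k) borel (\<lambda>\<omega>. u (V \<omega>))" by (simp add: comp_def)
    moreover have "integrable M (\<lambda>\<omega>. u (V \<omega>))"
      by (rule integrable_bounded_fun[OF _ that(2,3)]) measurable
    ultimately show "integrable M (\<lambda>\<omega>. Y \<omega> ^ k * u (V \<omega>))"
      "expectation (\<lambda>\<omega>. Y \<omega> ^ k * u (V \<omega>)) = expectation (\<lambda>\<omega>. Y \<omega> ^ k) * expectation (\<lambda>\<omega>. u (V \<omega>))"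
      using indep_var_integrable indep_var_lebesgue_integral Yk[OF that(1)] by blast+
  qed
  \<comment> \<open>\<open>P\<close> is the first-order Taylor polynomial of \<open>g1\<close> at
    \<open>V\<close> minus \<open>Y / \<delta>\<close> times the second-order one of
    \<open>g\<close>. Each term is written as a power of \<open>Y\<close> times a function of
    \<open>V\<close>, exponents 0 and 1 included, so that independence applies through
    \<open>prod\<close>.\<close>
  define P where "P \<omega> = (Y \<omega> ^ 0 * g1 (V \<omega>) - Y \<omega> ^ 2 * g1 (V \<omega>))
      + (\<delta> * (Y \<omega> ^ 1 * g2 (V \<omega>)) - \<delta> / 2 * (Y \<omega> ^ 3 * g2 (V \<omega>))) - (Y \<omega> ^ 1 * g (V \<omega>)) / \<delta>" for \<omega>
  define R where "R \<omega> = g1 (W \<omega>) - Y \<omega> * g (W \<omega>) / \<delta> - P \<omega>" for \<omega>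
  note p = prod[OF _ contg(1) B(1)] prod[OF _ contg(2) B(2)] prod[OF _ contg(3) B(3)]
  have intP: "integrable M P"
    unfolding P_def
    by (intro Bochner_Integration.integrable_diff Bochner_Integration.integrable_add
        integrable_mult_right integrable_divide p) simp_all
  have EP: "expectation P = 0"
    unfolding P_def using p[of 0] p[of 1] p[of 2] p[of 3] m1 m2 m3 by simp
  have Rb: "\<bar>R \<omega>\<bar> \<le> \<delta>\<^sup>2 * K * ((Y \<omega>)\<^sup>2 / 2 + Y \<omega> ^ 4 / 6)" for \<omega>
  proof -
    define t where "t = \<delta> * Y \<omega>"
    define r1 where "r1 = g1 (V \<omega> + t) - g1 (V \<omega>) - t * g2 (V \<omega>)"
    define r2 where "r2 = g (V \<omega> + t) - g (V \<omega>) - t * g1 (V \<omega>) - t\<^sup>2 / 2 * g2 (V \<omega>)"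
    have r1: "\<bar>r1\<bar> \<le> K * t\<^sup>2 / 2"
      unfolding r1_def by (rule taylor_first_order_bound[OF g(2,3) K])
    have r2: "\<bar>r2\<bar> \<le> K * \<bar>t\<bar> ^ 3 / 6"
      unfolding r2_def by (rule taylor_second_order_bound[OF g K])
    \<comment> \<open>The remainder of \<open>g\<close> is cubic in
      \<open>t = \<delta> * Y \<omega>\<close>, so after division by \<open>\<delta>\<close> both
      remainders are of order \<open>\<delta>\<^sup>2\<close>.\<close>
    have "R \<omega> = r1 - Y \<omega> / \<delta> * r2"
      unfolding R_def P_def r1_def r2_def W_def t_def using d
      by (simp add: field_simps power2_eq_square power3_eq_cube)
    also have "\<bar>\<dots>\<bar> \<le> \<bar>r1\<bar> + \<bar>Y \<omega>\<bar> / \<delta> * \<bar>r2\<bar>"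
      using abs_triangle_ineq4[of r1 "Y \<omega> / \<delta> * r2"] d by (simp add: abs_mult)
    also have "\<dots> \<le> K * t\<^sup>2 / 2 + \<bar>Y \<omega>\<bar> / \<delta> * (K * \<bar>t\<bar> ^ 3 / 6)"
      using r1 r2 d by (intro add_mono mult_left_mono) auto
    also have "\<bar>Y \<omega>\<bar> / \<delta> * (K * \<bar>t\<bar> ^ 3 / 6) = \<delta>\<^sup>2 * K * \<bar>Y \<omega>\<bar> ^ 4 / 6"
      using d by (simp add: t_def abs_mult power_mult_distrib eval_nat_numeral)
    also have "K * t\<^sup>2 / 2 + \<delta>\<^sup>2 * K * \<bar>Y \<omega>\<bar> ^ 4 / 6 = \<delta>\<^sup>2 * K * ((Y \<omega>)\<^sup>2 / 2 + Y \<omega> ^ 4 / 6)"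
      by (simp add: t_def power_mult_distrib algebra_simps power_even_abs)
    finally show ?thesis .
  qed
  have intQ: "integrable M (\<lambda>\<omega>. \<delta>\<^sup>2 * K * ((Y \<omega>)\<^sup>2 / 2 + Y \<omega> ^ 4 / 6))"
    by (intro integrable_mult_right Bochner_Integration.integrable_add integrable_divide Yk) simp_all
  have [measurable]: "P \<in> borel_measurable M" using intP by auto
  have intR: "integrable M R"
    by (rule Bochner_Integration.integrable_bound[OF intQ])
       (use order_trans[OF Rb abs_ge_self] in \<open>auto simp: R_def[abs_def]\<close>)
  have eq: "(\<lambda>\<omega>. g1 (W \<omega>) - Y \<omega> * g (W \<omega>) / \<delta>) = (\<lambda>\<omega>. P \<omega> + R \<omega>)" by (simp add: R_def)
  show "integrable M (\<lambda>\<omega>. g1 (W \<omega>) - Y \<omega> * g (W \<omega>) / \<delta>)"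
    unfolding eq by (intro Bochner_Integration.integrable_add intP intR)
  have "\<bar>expectation R\<bar> \<le> expectation (\<lambda>\<omega>. \<delta>\<^sup>2 * K * ((Y \<omega>)\<^sup>2 / 2 + Y \<omega> ^ 4 / 6))"
    by (rule order_trans[OF integral_abs_bound integral_mono]) (use intR intQ Rb in auto)
  also have "\<dots> = \<delta>\<^sup>2 * K * (1 / 2 + expectation (\<lambda>\<omega>. Y \<omega> ^ 4) / 6)"
    using Yk[of 2] Y4 m2 by simp
  finally show "\<bar>expectation (\<lambda>\<omega>. g1 (W \<omega>) - Y \<omega> * g (W \<omega>) / \<delta>)\<bar>
      \<le> \<delta>\<^sup>2 * K * (1 / 2 + expectation (\<lambda>\<omega>. Y \<omega> ^ 4) / 6)"
    unfolding eq using intP intR EP by simp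
qed

text \<open>With \<open>\<delta> = 1 / sqrt n\<close>, the product \<open>W * g W\<close> is the
  average over \<open>k\<close> of \<open>Xs k * g W / \<delta>\<close>. Pairing each summand with
  one copy of \<open>g1 W\<close> reduces the claim to the exchange bound, where \<open>V\<close> is
  \<open>\<delta>\<close> times the sum of the other variables, independent of \<open>Xs k\<close>.
  The average of \<open>n\<close> equal bounds keeps the factor
  \<open>\<delta>\<^sup>2 = 1 / n\<close>.\<close>

lemma clt_stein_bound:
  fixes Xs :: "nat \<Rightarrow> 'a \<Rightarrow> real" and g :: "real \<Rightarrow> real"
  assumes n: "n \<ge> 1" and ind: "indep_vars (\<lambda>_. borel) Xs {1..n}"
    and X4: "\<And>k. k \<in> {1..n} \<Longrightarrow> integrable M (\<lambda>\<omega>. Xs k \<omega> ^ 4)"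
    and m1: "\<And>k. k \<in> {1..n} \<Longrightarrow> expectation (Xs k) = 0"
    and m2: "\<And>k. k \<in> {1..n} \<Longrightarrow> expectation (\<lambda>\<omega>. (Xs k \<omega>)\<^sup>2) = 1"
    and m3: "\<And>k. k \<in> {1..n} \<Longrightarrow> expectation (\<lambda>\<omega>. Xs k \<omega> ^ 3) = 0"
    and m4: "\<And>k. k \<in> {1..n} \<Longrightarrow> expectation (\<lambda>\<omega>. Xs k \<omega> ^ 4) = m"
    and g: "\<And>x. (g has_real_derivative g1 x) (at x)" "\<And>x. (g1 has_real_derivative g2 x) (at x)"
      "\<And>x. (g2 has_real_derivative g3 x) (at x)"
    and B: "\<And>x. \<bar>g x\<bar> \<le> B" "\<And>x. \<bar>g1 x\<bar> \<le> B" "\<And>x. \<bar>g2 x\<bar> \<le> B" and K: "\<And>x. \<bar>g3 x\<bar> \<le> K"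
  defines "W \<equiv> \<lambda>\<omega>. (\<Sum>k=1..n. Xs k \<omega>) / sqrt (real n)"
  shows "\<bar>expectation (\<lambda>\<omega>. g1 (W \<omega>) - W \<omega> * g (W \<omega>))\<bar> \<le> K * (1 / 2 + m / 6) / real n"
proof -
  define \<delta> where "\<delta> = 1 / sqrt (real n)"
  have d: "\<delta> > 0" and d2: "\<delta>\<^sup>2 = 1 / real n" using n by (simp_all add: \<delta>_def power_divide)
  define T where "T k \<omega> = g1 (W \<omega>) - Xs k \<omega> * g (W \<omega>) / \<delta>" for k \<omega>
  have T: "integrable M (T k)" "\<bar>expectation (T k)\<bar> \<le> \<delta>\<^sup>2 * K * (1 / 2 + m / 6)"
    if k: "k \<in> {1..n}" for k
  proof -
    define V where "V \<omega> = \<delta> * (\<Sum>i\<in>{1..n} - {k}. Xs i \<omega>)" for \<omega>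
    have "indep_var borel (Xs k) borel (\<lambda>\<omega>. \<Sum>i\<in>{1..n} - {k}. Xs i \<omega>)"
      using k ind by (intro indep_vars_sum) (auto simp: insert_absorb)
    then have "indep_var borel (id \<circ> Xs k) borel ((\<lambda>x. \<delta> * x) \<circ> (\<lambda>\<omega>. \<Sum>i\<in>{1..n} - {k}. Xs i \<omega>))"
      by (rule indep_var_compose) measurable
    then have indV: "indep_var borel (Xs k) borel V" by (simp add: comp_def V_def[abs_def])
    have "(\<Sum>i=1..n. Xs i \<omega>) = Xs k \<omega> + (\<Sum>i\<in>{1..n} - {k}. Xs i \<omega>)" for \<omega>
      using k by (intro sum.remove) auto
    then have W: "W = (\<lambda>\<omega>. V \<omega> + \<delta> * Xs k \<omega>)"
      unfolding W_def V_def \<delta>_def by (simp add: add_divide_distrib add.commute)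
    note st = stein_exchange_bound[OF indV X4[OF k] m1[OF k] m2[OF k] m3[OF k] g B K d]
    show "integrable M (T k)" "\<bar>expectation (T k)\<bar> \<le> \<delta>\<^sup>2 * K * (1 / 2 + m / 6)"
      using st unfolding T_def[abs_def] W m4[OF k] by auto
  qed
  have eq: "g1 (W \<omega>) - W \<omega> * g (W \<omega>) = (\<Sum>k=1..n. T k \<omega>) / real n" for \<omega>
  proof -
    have "(\<Sum>k=1..n. T k \<omega>) = real n * g1 (W \<omega>) - (\<Sum>k=1..n. Xs k \<omega>) * g (W \<omega>) / \<delta>"
      by (simp add: T_def sum_subtractf sum_distrib_right sum_divide_distrib)
    also have "(\<Sum>k=1..n. Xs k \<omega>) = W \<omega> * (real n * \<delta>)"
      using n by (simp add: W_def \<delta>_def real_div_sqrt)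
    finally show ?thesis using n d by (simp add: field_simps)
  qed
  have "expectation (\<lambda>\<omega>. g1 (W \<omega>) - W \<omega> * g (W \<omega>)) = (\<Sum>k=1..n. expectation (T k)) / real n"
    unfolding eq using T(1) by (simp add: Bochner_Integration.integral_sum)
  also have "\<bar>\<dots>\<bar> \<le> (\<Sum>k=1..n. \<bar>expectation (T k)\<bar>) / real n"
    by (simp add: divide_right_mono)
  also have "\<dots> \<le> (\<Sum>k=1..n. \<delta>\<^sup>2 * K * (1 / 2 + m / 6)) / real n"
    by (intro divide_right_mono sum_mono T(2)) simp_all
  also have "\<dots> = K * (1 / 2 + m / 6) / real n"
    using n by (simp add: d2)
  finally show ?thesis .
qed

end

text \<open>Both means are close to the same \<open>c\<close>. The choice of \<open>C\<close> makes
  \<open>1 / 2 + E X^4 / 6\<close> equal to \<open>1 - C\<close>, which multiplies the Stein factor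
  \<open>4 * b\<close>; the term \<open>2 * C * a\<close> is the third-moment bound 2 times
  \<open>C / \<gamma> ^ 4\<close> times the bound \<open>a\<close> on \<open>g\<close>, up to the
  common denominator.\<close>

lemma gaussian_comparison_bound:
  fixes M :: "'a measure" and N :: "'b measure" and f :: "real \<Rightarrow> real"
  assumes "prob_space M" and n: "n \<ge> 1"
    and X: "X \<in> borel_measurable M" and ind: "prob_space.indep_vars M (\<lambda>_. borel) Xs {1..n}"
    and dist: "\<And>k. k \<in> {1..n} \<Longrightarrow> distr M borel (Xs k) = distr M borel X"
    and sym: "symmetric_rv M X" and X4: "integrable M (\<lambda>\<omega>. X \<omega> ^ 4)"
    and m1: "(\<integral>\<omega>. X \<omega> \<partial>M) = 0" and m2: "(\<integral>\<omega>. (X \<omega>)\<^sup>2 \<partial>M) = 1"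
    and C: "C = (3 - (\<integral>\<omega>. X \<omega> ^ 4 \<partial>M)) / 6" "C \<ge> 0" and g: "\<gamma> > 0" "\<gamma> ^ 4 = real n"
    and H: "H \<in> borel_measurable N" "distr N borel H = H_law (Phi C) \<gamma>"
    and f1: "\<And>x. (f has_real_derivative f1 x) (at x)"
    and f2: "\<And>x. (f1 has_real_derivative f2 x) (at x)"
    and B: "\<And>x. \<bar>f x\<bar> \<le> B" and a: "\<And>x. \<bar>f1 x\<bar> \<le> a" and b: "\<And>x. \<bar>f2 x\<bar> \<le> b"
  shows "\<bar>(\<integral>\<omega>. f ((\<Sum>k=1..n. Xs k \<omega>) / sqrt (real n)) \<partial>M) - (\<integral>\<omega>. f (H \<omega> / \<gamma>) \<partial>N)\<bar>
    \<le> (4 * (1 - C) * b + 2 * C * a) / \<gamma> ^ 4"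
proof -
  interpret prob_space M by fact
  obtain c g g1 g2 g3 D where g_der: "\<And>x. (g has_real_derivative g1 x) (at x)"
      "\<And>x. (g1 has_real_derivative g2 x) (at x)" "\<And>x. (g2 has_real_derivative g3 x) (at x)"
    and eq: "\<And>x. g1 x = x * g x + (f x - c)"
    and bounds: "\<And>x. \<bar>g x\<bar> \<le> a" "\<And>x. \<bar>g1 x\<bar> \<le> D" "\<And>x. \<bar>g2 x\<bar> \<le> D" "\<And>x. \<bar>g3 x\<bar> \<le> 4 * b"
    by (rule gaussian_stein_solution[OF f1 f2 B a b]) (rule that)
  define W where "W = (\<lambda>\<omega>. (\<Sum>k=1..n. Xs k \<omega>) / sqrt (real n))"
  have contf: "continuous_on UNIV f" by (rule DERIV_continuous_on[OF f1])
  have [measurable]: "f \<in> borel_measurable borel" by (rule borel_measurable_continuous_onI[OF contf])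
  note [measurable] = X H(1)
  have Xs [measurable]: "Xs k \<in> borel_measurable M" if "k \<in> {1..n}" for k
    using ind that unfolding indep_vars_def by auto
  have mom: "expectation (\<lambda>\<omega>. Xs k \<omega> ^ j) = expectation (\<lambda>\<omega>. X \<omega> ^ j)"
    if k: "k \<in> {1..n}" for k j
    using integral_distr[OF Xs[OF k], of "\<lambda>x. x ^ j"] integral_distr[OF X, of "\<lambda>x. x ^ j"] dist[OF k]
    by simp
  have Xs4: "integrable M (\<lambda>\<omega>. Xs k \<omega> ^ 4)" if k: "k \<in> {1..n}" for k
    using integrable_distr_eq[OF Xs[OF k], of "\<lambda>x. x ^ 4"] integrable_distr_eq[OF X, of "\<lambda>x. x ^ 4"]
      dist[OF k] X4 by simp
  \<comment> \<open>By symmetry the third moment equals its own negative.\<close>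
  have "expectation (\<lambda>\<omega>. X \<omega> ^ 3) = expectation (\<lambda>\<omega>. (- X \<omega>) ^ 3)"
    using integral_distr[OF X, of "\<lambda>x. x ^ 3"]
      integral_distr[OF borel_measurable_uminus[OF X], of "\<lambda>x. x ^ 3"] sym
    by (simp add: symmetric_rv_def)
  then have m3: "expectation (\<lambda>\<omega>. X \<omega> ^ 3) = 0" by simp
  \<comment> \<open>The exchange argument takes one common bound for \<open>g\<close>,
    \<open>g1\<close> and \<open>g2\<close>; it serves integrability and does not enter the
    estimate.\<close>
  have bounds_max: "\<bar>g x\<bar> \<le> max a D" "\<bar>g1 x\<bar> \<le> max a D" "\<bar>g2 x\<bar> \<le> max a D" for x
    using bounds(1-3)[of x] by linarith+
  have "\<bar>expectation (\<lambda>\<omega>. g1 (W \<omega>) - W \<omega> * g (W \<omega>))\<bar>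
      \<le> 4 * b * (1 / 2 + expectation (\<lambda>\<omega>. X \<omega> ^ 4) / 6) / real n"
    unfolding W_def
    by (rule clt_stein_bound[OF n ind Xs4 _ _ _ mom g_der bounds_max bounds(4)])
       (use mom[of _ 1] m1 m2 m3 in \<open>simp_all add: mom\<close>)
  moreover have "1 / 2 + expectation (\<lambda>\<omega>. X \<omega> ^ 4) / 6 = 1 - C" by (simp add: C(1) field_simps)
  moreover have "g1 (W \<omega>) - W \<omega> * g (W \<omega>) = f (W \<omega>) - c" for \<omega> by (simp add: eq)
  moreover have "integrable M (\<lambda>\<omega>. f (W \<omega>))"
    by (rule integrable_bounded_fun[OF _ contf B]) (simp add: W_def)
  ultimately have "\<bar>expectation (\<lambda>\<omega>. f (W \<omega>)) - c\<bar> \<le> 4 * b * (1 - C) / real n"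
    by (simp add: prob_space)
  moreover have "(\<integral>\<omega>. f (H \<omega> / \<gamma>) \<partial>N) = (\<integral>x. f (x / \<gamma>) \<partial>H_law (Phi C) \<gamma>)"
    unfolding H(2)[symmetric] by (subst integral_distr) simp_all
  then have "\<bar>(\<integral>\<omega>. f (H \<omega> / \<gamma>) \<partial>N) - c\<bar> \<le> 2 * (C / \<gamma> ^ 4) * a"
    unfolding integral_H_law_Phi[OF g(1) \<open>f \<in> borel_measurable borel\<close>]
    using quartic_mean_stein_bound[OF _ g_der(1) eq contf B bounds(1), of "C / \<gamma> ^ 4"] C(2) g(1) by simp
  ultimately have "\<bar>expectation (\<lambda>\<omega>. f (W \<omega>)) - (\<integral>\<omega>. f (H \<omega> / \<gamma>) \<partial>N)\<bar>
      \<le> 4 * b * (1 - C) / real n + 2 * (C / \<gamma> ^ 4) * a"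
    by linarith
  also have "\<dots> = (4 * (1 - C) * b + 2 * C * a) / \<gamma> ^ 4"
    by (simp add: g(2) add_divide_distrib)
  finally show ?thesis by (simp add: W_def)
qed

section \<open>Comparison of the two laws\<close>

lemma abs_le_sup_norm:
  assumes "\<And>x. \<bar>u x\<bar> \<le> B"
  shows "\<bar>u x\<bar> \<le> sup_norm u"
  unfolding sup_norm_def by (rule cSUP_upper) (use assms in \<open>auto intro!: bdd_aboveI2\<close>)

lemma sup_norm_le: "(\<And>x. \<bar>u x\<bar> \<le> B) \<Longrightarrow> sup_norm u \<le> B"
  unfolding sup_norm_def by (rule cSUP_least) auto

lemma sup_norm_nonneg: "(\<And>x. \<bar>u x\<bar> \<le> B) \<Longrightarrow> 0 \<le> sup_norm u"
  by (rule order_trans[OF abs_ge_zero abs_le_sup_norm])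

lemma d_H2_Phi_le:
  assumes "\<And>h. h \<in> H2_Phi \<Longrightarrow> \<bar>(\<integral>\<omega>. h (U \<omega>) \<partial>M) - (\<integral>\<omega>. h (V \<omega>) \<partial>N)\<bar> \<le> B"
  shows "d_H2_Phi M U N V \<le> B"
  unfolding d_H2_Phi_def by (rule cSUP_least) (use H2_Phi_zero assms in auto)

lemma H2_PhiD:
  assumes "h \<in> H2_Phi"
  shows "(h has_real_derivative deriv h x) (at x)"
    and "(deriv h has_real_derivative deriv (deriv h) x) (at x)"
    and "\<bar>h x\<bar> \<le> 1" and "\<bar>deriv h x\<bar> \<le> 1" and "\<bar>deriv (deriv h) x\<bar> \<le> 1"
  using assms unfolding H2_Phi_def
  by (auto simp: DERIV_deriv_iff_real_differentiable differentiable_on_def)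

theorem theorem4p4:
  fixes M :: "'a measure"
    and X :: "'a \<Rightarrow> real"
    and Xs :: "nat \<Rightarrow> 'a \<Rightarrow> real"
    and N :: "nat \<Rightarrow> 'b measure"
    and H :: "nat \<Rightarrow> 'b \<Rightarrow> real"
    and Z :: "nat \<Rightarrow> 'a \<Rightarrow> real"
    and \<gamma> :: "nat \<Rightarrow> real"
    and C :: real
  assumes "prob_space M"
    and "X \<in> borel_measurable M"
    and "prob_space.indep_vars M (\<lambda>_. borel) Xs {1..}"
    and "\<And>k. k \<ge> 1 \<Longrightarrow> distr M borel (Xs k) = distr M borel X"
    and "symmetric_rv M X"
    and "integrable M (\<lambda>\<omega>. X \<omega> ^ 4)"
    and "(\<integral>\<omega>. X \<omega> \<partial>M) = 0"
    and "(\<integral>\<omega>. (X \<omega>)\<^sup>2 \<partial>M) = 1"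
    and "(\<integral>\<omega>. X \<omega> ^ 4 \<partial>M) < 3"
    and "\<And>n \<omega>. Z n \<omega> = 1 / real n powr (1 / 4) * (\<Sum>k=1..n. Xs k \<omega>)"
    and "\<And>n. \<gamma> n = real n powr (1 / 4)"
    and "C = (3 - (\<integral>\<omega>. X \<omega> ^ 4 \<partial>M)) / 6"
    and "\<And>n. n \<ge> 1 \<Longrightarrow> prob_space (N n)"
    and "\<And>n. n \<ge> 1 \<Longrightarrow> H n \<in> borel_measurable (N n)"
    and "\<And>n. n \<ge> 1 \<Longrightarrow> distr (N n) borel (H n) = H_law (Phi C) (\<gamma> n)"
  shows "(\<forall>h\<in>H2_Phi. \<forall>n\<ge>1.
            \<bar>(\<integral>\<omega>. h (Z n \<omega>) \<partial>M) - (\<integral>\<omega>. h (H n \<omega>) \<partial>N n)\<bar>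
              \<le> (3 + 2 * C + 35 * C / \<gamma> n ^ 4) * ((2 - 3 * C) / (\<gamma> n)\<^sup>2) * sup_norm (deriv (deriv h))
                + 66 * C / \<gamma> n ^ 3 * sup_norm (deriv h))
       \<and> (\<exists>R. R \<in> O(\<lambda>n. 1 / \<gamma> n ^ 3) \<and>
            (\<forall>n\<ge>1. d_H2_Phi M (Z n) (N n) (H n)
                      \<le> (3 + 2 * C) * (2 - 3 * C) / (\<gamma> n)\<^sup>2 + R n))
       \<and> (\<exists>R. R \<in> O(\<lambda>n. 1 / \<gamma> n ^ 8) \<and>
            (\<forall>n\<ge>1. d_H2_Phi M (\<lambda>\<omega>. Z n \<omega> / \<gamma> n) (N n) (\<lambda>\<omega>. H n \<omega> / \<gamma> n)
                      \<le> (3 + 2 * C) * (2 - 3 * C) / \<gamma> n ^ 4 + R n))"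
proof -
  note X = assms(2) and X4 = assms(6) and m2 = assms(8) and C_def = assms(12)
  interpret prob_space M by fact
  have "integrable M (\<lambda>\<omega>. X \<omega> ^ 2)" using integrable_power_le_4[OF X X4, of 2] by simp
  \<comment> \<open>The variance of the square of \<open>X\<close> is nonnegative, so the fourth
    moment is at least 1 and \<open>C \<le> 1 / 3\<close>.\<close>
  moreover have "0 \<le> (\<integral>\<omega>. ((X \<omega>)\<^sup>2 - 1)\<^sup>2 \<partial>M)" by simp
  moreover have "((X \<omega>)\<^sup>2 - 1)\<^sup>2 = X \<omega> ^ 4 - 2 * (X \<omega>)\<^sup>2 + 1" for \<omega>
    by (simp add: power2_eq_square eval_nat_numeral algebra_simps)
  ultimately have "0 \<le> (\<integral>\<omega>. X \<omega> ^ 4 \<partial>M) - 1" using X4 m2 by (simp add: prob_space)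
  then have C: "0 \<le> C" "C \<le> 1 / 3" using C_def assms(9) by simp_all
  have gpos: "\<gamma> n > 0" if "n \<ge> 1" for n using that by (simp add: assms(11))
  have g2: "(\<gamma> n)\<^sup>2 = sqrt (real n)" and g4: "\<gamma> n ^ 4 = real n" if "n \<ge> 1" for n
    using that by (simp_all add: assms(11) powr_power powr_half_sqrt)
  have ZW: "Z n \<omega> / \<gamma> n = (\<Sum>k=1..n. Xs k \<omega>) / sqrt (real n)" if "n \<ge> 1" for n \<omega>
    using g2[OF that] by (simp add: assms(10) assms(11)[symmetric] power2_eq_square)
  have key: "\<bar>(\<integral>\<omega>. u (Z n \<omega> / \<gamma> n) \<partial>M) - (\<integral>\<omega>. u (H n \<omega> / \<gamma> n) \<partial>N n)\<bar>
      \<le> (4 * (1 - C) * b + 2 * C * a) / \<gamma> n ^ 4"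
    if n: "n \<ge> 1" and f: "\<And>x. (u has_real_derivative v x) (at x)"
      "\<And>x. (v has_real_derivative w x) (at x)"
      "\<And>x. \<bar>u x\<bar> \<le> 1" "\<And>x. \<bar>v x\<bar> \<le> a" "\<And>x. \<bar>w x\<bar> \<le> b" for n u v w a b
  proof -
    have "indep_vars (\<lambda>_. borel) Xs {1..n}" by (rule indep_vars_subset[OF assms(3)]) auto
    then show ?thesis
      unfolding ZW[OF n]
      by (intro gaussian_comparison_bound[OF assms(1) n X _ _ assms(5) X4 assms(7) m2 C_def C(1)
            gpos[OF n] g4[OF n] assms(14,15)[OF n] f])
         (simp_all add: assms(4))
  qed
  \<comment> \<open>The right-hand side is 6 - 5 C - 6 C^2, at least 6 - 7 C because C^2 is at most
    C / 3; then \<open>C \<le> 1 / 3\<close> suffices for both claims. The first concerns the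
    second-derivative term alone, the second both terms when the norms are replaced by 1.\<close>
  have poly: "4 * (1 - C) \<le> (3 + 2 * C) * (2 - 3 * C)"
      "4 * (1 - C) + 2 * C \<le> (3 + 2 * C) * (2 - 3 * C)"
  proof -
    have "C * C \<le> C * (1 / 3)" using C by (intro mult_left_mono)
    then show "4 * (1 - C) \<le> (3 + 2 * C) * (2 - 3 * C)"
      "4 * (1 - C) + 2 * C \<le> (3 + 2 * C) * (2 - 3 * C)"
      using C by (simp_all add: algebra_simps)
  qed
  \<comment> \<open>\<open>key\<close> is applied to the dilation of \<open>h\<close> by
    \<open>\<gamma> n\<close>, whose derivative bounds gain one and two factors
    \<open>\<gamma> n\<close>.\<close>
  have unscaled: "\<bar>(\<integral>\<omega>. h (Z n \<omega>) \<partial>M) - (\<integral>\<omega>. h (H n \<omega>) \<partial>N n)\<bar>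
      \<le> 4 * (1 - C) / (\<gamma> n)\<^sup>2 * sup_norm (deriv (deriv h)) + 2 * C / \<gamma> n ^ 3 * sup_norm (deriv h)"
    if h: "h \<in> H2_Phi" and n: "n \<ge> 1" for h n
  proof -
    note hD = H2_PhiD[OF h] and gp = gpos[OF n]
    define a where "a = sup_norm (deriv h)"
    define b where "b = sup_norm (deriv (deriv h))"
    have lin: "((\<lambda>x. \<gamma> n * x) has_real_derivative \<gamma> n) (at x)" for x
      by (auto intro!: derivative_eq_intros)
    have "\<bar>(\<integral>\<omega>. h (\<gamma> n * (Z n \<omega> / \<gamma> n)) \<partial>M) - (\<integral>\<omega>. h (\<gamma> n * (H n \<omega> / \<gamma> n)) \<partial>N n)\<bar>
        \<le> (4 * (1 - C) * ((\<gamma> n)\<^sup>2 * b) + 2 * C * (\<gamma> n * a)) / \<gamma> n ^ 4"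
    proof (rule key[OF n, of "\<lambda>x. h (\<gamma> n * x)" "\<lambda>x. \<gamma> n * deriv h (\<gamma> n * x)"
          "\<lambda>x. (\<gamma> n)\<^sup>2 * deriv (deriv h) (\<gamma> n * x)"])
      show "((\<lambda>x. h (\<gamma> n * x)) has_real_derivative \<gamma> n * deriv h (\<gamma> n * x)) (at x)" for x
        by (rule DERIV_cong[OF DERIV_chain2[OF hD(1) lin]]) simp
      show "((\<lambda>x. \<gamma> n * deriv h (\<gamma> n * x)) has_real_derivative
          (\<gamma> n)\<^sup>2 * deriv (deriv h) (\<gamma> n * x)) (at x)" for x
        by (rule DERIV_cong[OF DERIV_cmult[OF DERIV_chain2[OF hD(2) lin]]])
           (simp add: power2_eq_square)
      show "\<bar>\<gamma> n * deriv h (\<gamma> n * x)\<bar> \<le> \<gamma> n * a" for x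
        using abs_le_sup_norm[of "deriv h", OF hD(4)] gp by (simp add: abs_mult a_def)
      show "\<bar>(\<gamma> n)\<^sup>2 * deriv (deriv h) (\<gamma> n * x)\<bar> \<le> (\<gamma> n)\<^sup>2 * b" for x
        using abs_le_sup_norm[of "deriv (deriv h)", OF hD(5)] by (simp add: abs_mult b_def mult_left_mono)
    qed (rule hD)
    also have "\<dots> = 4 * (1 - C) / (\<gamma> n)\<^sup>2 * b + 2 * C / \<gamma> n ^ 3 * a"
      using gp by (simp add: field_simps eval_nat_numeral)
    finally show ?thesis using gp by (simp add: a_def b_def)
  qed
  have "\<bar>(\<integral>\<omega>. h (Z n \<omega>) \<partial>M) - (\<integral>\<omega>. h (H n \<omega>) \<partial>N n)\<bar>
      \<le> (3 + 2 * C + 35 * C / \<gamma> n ^ 4) * ((2 - 3 * C) / (\<gamma> n)\<^sup>2) * sup_norm (deriv (deriv h))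
        + 66 * C / \<gamma> n ^ 3 * sup_norm (deriv h)"
    if h: "h \<in> H2_Phi" and n: "n \<ge> 1" for h n
  proof -
    note gp = gpos[OF n]
    \<comment> \<open>The summand with 35 is nonnegative and only enlarges the first factor; below,
      2 is likewise enlarged to 66.\<close>
    have "4 * (1 - C) \<le> (3 + 2 * C + 35 * C / \<gamma> n ^ 4) * (2 - 3 * C)"
      using poly(1) C gp by (intro order_trans[OF poly(1)] mult_right_mono) auto
    then have "4 * (1 - C) / (\<gamma> n)\<^sup>2 \<le> (3 + 2 * C + 35 * C / \<gamma> n ^ 4) * (2 - 3 * C) / (\<gamma> n)\<^sup>2"
      by (rule divide_right_mono) simp
    moreover have "2 * C / \<gamma> n ^ 3 \<le> 66 * C / \<gamma> n ^ 3"
      using C gp by (intro divide_right_mono) auto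
    ultimately show ?thesis
      using sup_norm_nonneg[of "deriv h", OF H2_PhiD(4)[OF h]]
        sup_norm_nonneg[of "deriv (deriv h)", OF H2_PhiD(5)[OF h]]
      by (intro order_trans[OF unscaled[OF h n]] add_mono mult_right_mono) auto
  qed
  \<comment> \<open>The remainder \<open>2 * C / \<gamma> n ^ 3\<close> is the first-derivative term
    of \<open>unscaled\<close> with the norm replaced by 1.\<close>
  moreover have "d_H2_Phi M (Z n) (N n) (H n) \<le> (3 + 2 * C) * (2 - 3 * C) / (\<gamma> n)\<^sup>2 + 2 * C / \<gamma> n ^ 3"
    if n: "n \<ge> 1" for n
  proof (rule d_H2_Phi_le)
    fix h assume h: "h \<in> H2_Phi"
    note gp = gpos[OF n]
    have "4 * (1 - C) / (\<gamma> n)\<^sup>2 * sup_norm (deriv (deriv h)) \<le> (3 + 2 * C) * (2 - 3 * C) / (\<gamma> n)\<^sup>2 * 1"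
    proof (rule mult_mono)
      show "4 * (1 - C) / (\<gamma> n)\<^sup>2 \<le> (3 + 2 * C) * (2 - 3 * C) / (\<gamma> n)\<^sup>2"
        using poly(1) by (rule divide_right_mono) simp
      show "sup_norm (deriv (deriv h)) \<le> 1" by (rule sup_norm_le[OF H2_PhiD(5)[OF h]])
      show "0 \<le> sup_norm (deriv (deriv h))" by (rule sup_norm_nonneg[OF H2_PhiD(5)[OF h]])
      show "0 \<le> (3 + 2 * C) * (2 - 3 * C) / (\<gamma> n)\<^sup>2" using C by simp
    qed
    moreover have "2 * C / \<gamma> n ^ 3 * sup_norm (deriv h) \<le> 2 * C / \<gamma> n ^ 3 * 1"
      using C gp by (intro mult_left_mono sup_norm_le H2_PhiD(4)[OF h]) auto
    ultimately show "\<bar>(\<integral>\<omega>. h (Z n \<omega>) \<partial>M) - (\<integral>\<omega>. h (H n \<omega>) \<partial>N n)\<bar>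
        \<le> (3 + 2 * C) * (2 - 3 * C) / (\<gamma> n)\<^sup>2 + 2 * C / \<gamma> n ^ 3"
      using unscaled[OF h n] by linarith
  qed
  \<comment> \<open>The estimate with constant \<open>2 * C\<close> holds for every
    \<open>n\<close>; at \<open>n = 0\<close>, where \<open>\<gamma> n = 0\<close>, both quotients
    are 0.\<close>
  moreover have "(\<lambda>n. 2 * C / \<gamma> n ^ 3) \<in> O(\<lambda>n. 1 / \<gamma> n ^ 3)"
    by (intro bigoI[of _ "2 * C"] always_eventually) (simp add: C)
  \<comment> \<open>Here \<open>key\<close> applies to \<open>h\<close> itself with both derivative
    bounds equal to 1, so the two terms have the same order and \<open>poly(2)\<close> absorbs them
    together. The literal \<open>+ 0\<close> exhibits the zero function as the witness for the
    remainder.\<close>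
  moreover have "d_H2_Phi M (\<lambda>\<omega>. Z n \<omega> / \<gamma> n) (N n) (\<lambda>\<omega>. H n \<omega> / \<gamma> n)
      \<le> (3 + 2 * C) * (2 - 3 * C) / \<gamma> n ^ 4 + 0" if n: "n \<ge> 1" for n
  proof (rule d_H2_Phi_le)
    fix h assume h: "h \<in> H2_Phi"
    have "(4 * (1 - C) * 1 + 2 * C * 1) / \<gamma> n ^ 4 \<le> (3 + 2 * C) * (2 - 3 * C) / \<gamma> n ^ 4"
      using poly(2) by (intro divide_right_mono) auto
    with key[OF n H2_PhiD[OF h]]
    show "\<bar>(\<integral>\<omega>. h (Z n \<omega> / \<gamma> n) \<partial>M) - (\<integral>\<omega>. h (H n \<omega> / \<gamma> n) \<partial>N n)\<bar>
        \<le> (3 + 2 * C) * (2 - 3 * C) / \<gamma> n ^ 4 + 0"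
      by linarith
  qed
  moreover have "(\<lambda>n. 0 :: real) \<in> O(\<lambda>n. 1 / \<gamma> n ^ 8)" by simp
  ultimately show ?thesis by blast
qed

end
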